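(* Let $(w_n)_{n\in\mathbb{N}}$ be a sequence of non-negative numbers, and let $\alpha\in(-\infty,1]$. The following statements are equivalent. (a) There exists a constant $C>0$ such that for all $x\ge 2$, $$\sum_{n\le x} w_n \le C\,\frac{x}{(\log x)^\alpha}.$$ (b) The space $\mathscr{H}_w$ is locally embedded in the space $D_\alpha(\mathbb{C}_{1/2})$.
   Context: Notation: $s=\sigma+\mathrm{i}t$ is the complex variable, $\mathbb{C}_{1/2}=\{s\in\mathbb{C}:\operatorname{Re}s>1/2\}$, and $\mathrm{d}m$ is Lebesgue measure in the plane. For a sequence $(w_n)_{n\in\mathbb{N}}$ of non-negative numbers, $$\mathscr{H}_w=\Big\{F(s)=\sum_{n\in\mathbb{N}}a_nn^{-s}:\ \|F\|_{\mathscr{H}_w}^2:=\sum_{n}\frac{|a_n|^2}{w_n}<\infty\Big\};$$ by convention, if $w_n=0$ the basis vector $n^{-s}$ is excluded (i.e. $a_n=0$). For a bounded interval $I\subset\mathbb{R}$ put $\Omega_I=(1/2,1]\times I$, i.e. $\Omega_I=\{\sigma+\mathrm{i}t: 1/2<\sigma\le 1,\ t\in I\}$. Definition (local embedding). For $\alpha\le1$, $\mathscr{H}_w$ is locally embedded in $D_\alpha(\mathbb{C}_{1/2})$ if for every finite interval $I$ there is a constant $C>0$ such that, for all $F\in\mathscr{H}_w$: - if $\alpha<0$: $\displaystyle\int_{\Omega_I}|F(s)|^2\left(\sigma-\tfrac12\right)^{-\alpha-1}\mathrm{d}m(s)\le C\|F\|_{\mathscr{H}_w}^2$; - if $\alpha=0$: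 $\displaystyle\sup_{\sigma>1/2}\int_I|F(\sigma+\mathrm{i}t)|^2\,\mathrm{d}t\le C\|F\|_{\mathscr{H}_w}^2$; - if $0<\alpha\le1$: $\displaystyle\int_{\Omega_I}|F'(s)|^2\left(\sigma-\tfrac12\right)^{-\alpha+1}\mathrm{d}m(s)\le C\|F\|_{\mathscr{H}_w}^2$. (This includes the understanding that elements of $\mathscr{H}_w$ define analytic functions on $\mathbb{C}_{1/2}$.) *)

theory Defs
  imports "HOL-Complex_Analysis.Complex_Analysis"
begin

text \<open>
  Sequences are indexed by the positive integers: a function on \<^typ>\<open>nat\<close> is only ever
  inspected at arguments \<open>Suc n\<close>, and its value at \<open>0\<close> is irrelevant. An element of
  \<open>\<H>\<^sub>w\<close> is represented by its coefficient sequence.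
\<close>

definition half_plane :: "complex set" where
  "half_plane = {s. Re s > 1 / 2}"

definition dirichlet_term :: "(nat \<Rightarrow> complex) \<Rightarrow> complex \<Rightarrow> nat \<Rightarrow> complex" where
  "dirichlet_term a s n = a (Suc n) * of_nat (Suc n) powr (- s)"

definition dirichlet_series :: "(nat \<Rightarrow> complex) \<Rightarrow> complex \<Rightarrow> complex" where
  "dirichlet_series a s = (\<Sum>n. dirichlet_term a s n)"

text \<open>If \<open>w n = 0\<close> then \<open>a n = 0\<close> is required, and the corresponding summand is \<open>0 / 0 = 0\<close>.\<close>

definition H_space :: "(nat \<Rightarrow> real) \<Rightarrow> (nat \<Rightarrow> complex) set" where
  "H_space w = {a. (\<forall>n. w (Suc n) = 0 \<longrightarrow> a (Suc n) = 0) \<and>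
                   summable (\<lambda>n. (cmod (a (Suc n)))\<^sup>2 / w (Suc n))}"

definition H_norm_sq :: "(nat \<Rightarrow> real) \<Rightarrow> (nat \<Rightarrow> complex) \<Rightarrow> real" where
  "H_norm_sq w a = (\<Sum>n. (cmod (a (Suc n)))\<^sup>2 / w (Suc n))"

definition strip :: "real set \<Rightarrow> complex set" where
  "strip I = {s. 1 / 2 < Re s \<and> Re s \<le> 1 \<and> Im s \<in> I}"

text \<open>
  The left-hand sides of the local embedding inequalities, as extended non-negative reals, so
  that a finite bound includes the finiteness of the integrals. Only \<open>\<alpha> \<le> 1\<close> is meaningful.
\<close>

definition local_energy :: "real \<Rightarrow> real set \<Rightarrow> (complex \<Rightarrow> complex) \<Rightarrow> ennreal" where
  "local_energy \<alpha> I F =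
     (if \<alpha> < 0 then
        (\<integral>\<^sup>+ s\<in>strip I. ennreal ((cmod (F s))\<^sup>2 * (Re s - 1 / 2) powr (- \<alpha> - 1)) \<partial>lborel)
      else if \<alpha> = 0 then
        (SUP \<sigma>\<in>{1 / 2<..}. \<integral>\<^sup>+ t\<in>I. ennreal ((cmod (F (Complex \<sigma> t)))\<^sup>2) \<partial>lborel)
      else
        (\<integral>\<^sup>+ s\<in>strip I. ennreal ((cmod (deriv F s))\<^sup>2 * (Re s - 1 / 2) powr (- \<alpha> + 1)) \<partial>lborel))"

definition locally_embedded :: "(nat \<Rightarrow> real) \<Rightarrow> real \<Rightarrow> bool" where
  "locally_embedded w \<alpha> \<longleftrightarrow>
     (\<forall>a\<in>H_space w. (\<forall>s\<in>half_plane. summable (dirichlet_term a s)) \<and>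
                     dirichlet_series a holomorphic_on half_plane) \<and>
     (\<forall>I. is_interval I \<and> bounded I \<longrightarrow>
        (\<exists>C>0. \<forall>a\<in>H_space w.
           local_energy \<alpha> I (dirichlet_series a) \<le> ennreal (C * H_norm_sq w a)))"

end

theory Submission
  imports Defs "HOL-Real_Asymp.Real_Asymp"
begin

text \<open>
  The coefficient bound implies the embedding by an orthogonality argument at scale \<open>1\<close>. The
  function \<open>T\<^sup>2 - t\<^sup>2\<close> on \<open>[-T, T]\<close> dominates the indicator of \<open>[-R, R]\<close> for \<open>T = R + 1\<close>, and its
  Fourier transform is \<open>O(1 / (1 + \<xi>\<^sup>2))\<close>. Hence, by Schur's test, the mean square of
  \<open>\<Sum> c\<^sub>n n\<^sup>-\<^sup>i\<^sup>t\<close> over \<open>[-R, R]\<close> is at most a constant times the sum over the dyadic blocks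
  \<open>[2\<^sup>k, 2\<^sup>k\<^sup>+\<^sup>1)\<close> of \<open>(\<Sum> |c\<^sub>n|)\<^sup>2\<close>. The Cauchy-Schwarz inequality with the weights \<open>w\<close> on each block and
  a Gamma integral in \<open>\<sigma> - 1/2\<close> produce exactly the power of \<open>k \<approx> log n\<close> that the coefficient
  bound compensates. Fatou's lemma passes from partial sums to the series.

  Conversely, the embedding is tested on the coefficients \<open>a\<^sub>n = w\<^sub>n\<close> for \<open>n\<close> in \<open>(x/2, x]\<close>. For
  \<open>0 \<le> t \<le> 1\<close> the summands nearly share their phase, so \<open>|F|\<close> is comparable to
  \<open>x\<^sup>-\<^sup>\<sigma> \<Sum> w\<^sub>n\<close>; restricting the integral to \<open>\<sigma> - 1/2 \<approx> 1 / log x\<close> bounds \<open>\<Sum> w\<^sub>n\<close> over the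
  block, and halving \<open>x\<close> repeatedly gives the full sum.
\<close>

subsection \<open>Mean values of trigonometric sums\<close>

lemma measurable_Complex_pair [measurable]:
  "(\<lambda>(x, y). Complex x y) \<in> borel_measurable (lborel \<Otimes>\<^sub>M lborel)"
  by (auto simp: lborel_prod Complex_eq case_prod_unfold
      intro!: borel_measurable_continuous_onI continuous_intros)

text \<open>Lebesgue measure is determined by its values on open boxes, and \<open>Complex\<close>
  pulls a box back to a product of two intervals. Integrals over a strip thereby become iterated
  integrals in the real and imaginary parts.\<close>

lemma lborel_complex_eq:
  "(lborel :: complex measure) = distr (lborel \<Otimes>\<^sub>M lborel) borel (\<lambda>(x, y). Complex x y)"
proof (rule lborel_eqI)
  show "sets (distr (lborel \<Otimes>\<^sub>M lborel) borel (\<lambda>(x, y). Complex x y)) = sets borel"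
    by simp
  fix l u :: complex
  assume lu: "\<And>b. b \<in> Basis \<Longrightarrow> l \<bullet> b \<le> u \<bullet> b"
  have le: "Re l \<le> Re u" "Im l \<le> Im u"
    using lu[of 1] lu[of \<i>] by (auto simp: Basis_complex_def)
  have "(\<lambda>(x, y). Complex x y) -` box l u = {Re l<..<Re u} \<times> {Im l<..<Im u}"
    by (auto simp: in_box_complex_iff)
  then have "emeasure (distr (lborel \<Otimes>\<^sub>M lborel) borel (\<lambda>(x, y). Complex x y)) (box l u) =
      emeasure (lborel \<Otimes>\<^sub>M lborel) ({Re l<..<Re u} \<times> {Im l<..<Im u})"
    by (simp add: emeasure_distr space_pair_measure)
  also have "\<dots> = ennreal (Re u - Re l) * ennreal (Im u - Im l)"
    using le by (simp add: lborel.emeasure_pair_measure_Times)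
  also have "\<dots> = ennreal (\<Prod>b\<in>Basis. (u - l) \<bullet> b)"
    using le by (simp add: Basis_complex_def ennreal_mult)
  finally show "emeasure (distr (lborel \<Otimes>\<^sub>M lborel) borel (\<lambda>(x, y). Complex x y)) (box l u) =
      ennreal (\<Prod>b\<in>Basis. (u - l) \<bullet> b)" .
qed

lemma nn_integral_lborel_complex:
  fixes f :: "complex \<Rightarrow> ennreal"
  assumes [measurable]: "f \<in> borel_measurable borel"
  shows "(\<integral>\<^sup>+s. f s \<partial>lborel) = (\<integral>\<^sup>+x. \<integral>\<^sup>+y. f (Complex x y) \<partial>lborel \<partial>lborel)"
proof -
  have "(\<integral>\<^sup>+s. f s \<partial>lborel) = (\<integral>\<^sup>+p. f (case p of (x, y) \<Rightarrow> Complex x y) \<partial>(lborel \<Otimes>\<^sub>M lborel))"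
    by (subst lborel_complex_eq) (simp add: nn_integral_distr)
  also have "\<dots> = (\<integral>\<^sup>+x. \<integral>\<^sup>+y. f (Complex x y) \<partial>lborel \<partial>lborel)"
    by (subst lborel.nn_integral_fst[symmetric]) simp_all
  finally show ?thesis .
qed

section \<open>A parabolic majorant and its Fourier transform\<close>

text \<open>For small frequency the integrand is bounded trivially. For large frequency integrate by
  parts: \<open>T\<^sup>2 - t\<^sup>2\<close> vanishes at both endpoints, so the boundary term of
  order \<open>1 / \<xi>\<close> drops out and the summable decay \<open>1 / \<xi>\<^sup>2\<close>
  is left.\<close>

lemma parabola_fourier_bound:
  fixes T \<xi> :: real
  assumes T: "T \<ge> 0"
  shows "cmod (integral {-T..T} (\<lambda>t. of_real (T\<^sup>2 - t\<^sup>2) * cis (\<xi> * t)))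
           \<le> (4 * T ^ 3 + 8 * T + 8) / (1 + \<xi>\<^sup>2)"
proof -
  define f where "f = (\<lambda>t. of_real (T\<^sup>2 - t\<^sup>2) * cis (\<xi> * t))"
  have int: "f integrable_on {-T..T}"
    unfolding f_def by (intro integrable_continuous_interval continuous_intros)
  show ?thesis
  proof (cases "\<bar>\<xi>\<bar> \<le> 1")
    case True
    then have xi: "\<xi>\<^sup>2 \<le> 1" by (simp add: abs_square_le_1)
    have "cmod (integral {-T..T} f) \<le> integral {-T..T} (\<lambda>t. T\<^sup>2)"
    proof (rule integral_norm_bound_integral[OF int])
      fix t assume "t \<in> {-T..T}"
      then have "t\<^sup>2 \<le> T\<^sup>2" by (auto simp: abs_le_square_iff[symmetric])
      then show "norm (f t) \<le> T\<^sup>2" by (simp add: f_def norm_mult del: of_real_diff)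
    qed (rule integrable_const_ivl)
    also have "\<dots> = 2 * T ^ 3" using T by (simp add: power2_eq_square power3_eq_cube)
    also have "\<dots> \<le> (4 * T ^ 3 + 8 * T + 8) / (1 + \<xi>\<^sup>2)"
    proof -
      have "2 * T ^ 3 * (1 + \<xi>\<^sup>2) \<le> 2 * T ^ 3 * 2"
        using xi T by (intro mult_left_mono) auto
      moreover have "1 + \<xi>\<^sup>2 > 0" by (simp add: add_pos_nonneg)
      ultimately show ?thesis using T by (simp add: pos_le_divide_eq)
    qed
    finally show ?thesis unfolding f_def .
  next
    case False
    then have x1: "\<bar>\<xi>\<bar> > 1" by simp
    define z where "z = \<i> * of_real \<xi>"
    have z: "z \<noteq> 0" "cmod z = \<bar>\<xi>\<bar>" using x1 by (auto simp: z_def norm_mult)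
    \<comment> \<open>With p the parabola, repeated integration by parts gives the antiderivative
      exp(z t) (p / z - p' / z^2 + p'' / z^3).\<close>
    define G where "G = (\<lambda>t::real. exp (z * of_real t) *
        (of_real (T\<^sup>2 - t\<^sup>2) / z + of_real (2 * t) / z\<^sup>2 - 2 / z ^ 3))"
    have "(f has_integral (G T - G (-T))) {-T..T}"
    proof (rule fundamental_theorem_of_calculus)
      fix t :: real
      have "((\<lambda>w. exp (z * w) * ((of_real (T\<^sup>2) - w\<^sup>2) / z + 2 * w / z\<^sup>2 - 2 / z ^ 3))
         has_field_derivative f t) (at (of_real t))"
        using z unfolding f_def
        by (auto intro!: derivative_eq_intros
            simp: cis_conv_exp z_def divide_simps power2_eq_square power3_eq_cube)
           (simp add: algebra_simps)?
      then have "((\<lambda>x. (\<lambda>w. exp (z * w) * ((of_real (T\<^sup>2) - w\<^sup>2) / z + 2 * w / z\<^sup>2 - 2 / z ^ 3)) (of_real x))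
         has_vector_derivative f t) (at t within {-T..T})"
        by (rule has_vector_derivative_real_field)
      then show "(G has_vector_derivative f t) (at t within {-T..T})"
        by (simp add: G_def)
    qed (use T in simp)
    then have eq: "integral {-T..T} f = G T - G (-T)" by (rule integral_unique)
    have ez: "cmod (exp (z * of_real t)) = 1" for t
      unfolding z_def using norm_exp_i_times[of "\<xi> * t"] by (simp add: mult_ac)
    have inv: "1 / \<bar>\<xi>\<bar> ^ 3 \<le> 1 / \<xi>\<^sup>2"
      using x1 power_increasing[of 2 3 "\<bar>\<xi>\<bar>"] by (simp add: frac_le)
    have Gb: "cmod (G t) \<le> (2 * T + 2) / \<xi>\<^sup>2" if "\<bar>t\<bar> = T" for t
    proof -
      have "T\<^sup>2 - t\<^sup>2 = 0" using that by auto
      then have "cmod (G t) = cmod (of_real (2 * t) / z\<^sup>2 - 2 / z ^ 3)"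
        by (simp only: G_def norm_mult ez) simp
      also have "\<dots> \<le> cmod (of_real (2 * t) / z\<^sup>2) + cmod (2 / z ^ 3)"
        by (rule norm_triangle_ineq4)
      also have "\<dots> = 2 * T / \<xi>\<^sup>2 + 2 * (1 / \<bar>\<xi>\<bar> ^ 3)"
        using that by (simp add: norm_divide norm_power norm_mult z)
      also have "\<dots> \<le> 2 * T / \<xi>\<^sup>2 + 2 * (1 / \<xi>\<^sup>2)"
        using inv by linarith
      finally show ?thesis by (simp add: add_divide_distrib)
    qed
    have "cmod (integral {-T..T} f) \<le> cmod (G T) + cmod (G (-T))"
      unfolding eq by (rule norm_triangle_ineq4)
    also have "\<dots> \<le> 2 * ((2 * T + 2) / \<xi>\<^sup>2)"
      using Gb[of T] Gb[of "-T"] T by (simp only: mult_2 abs_minus_cancel abs_of_nonneg add_mono)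
    also have "\<dots> \<le> (4 * T ^ 3 + 8 * T + 8) / (1 + \<xi>\<^sup>2)"
    proof -
      have q: "\<xi>\<^sup>2 \<ge> 1" using x1 by (metis abs_le_square_iff abs_one less_eq_real_def one_power2)
      have "(4 * T + 4) * (1 + \<xi>\<^sup>2) \<le> (4 * T + 4) * (2 * \<xi>\<^sup>2)"
        using q T by (intro mult_left_mono) auto
      also have "\<dots> \<le> (4 * T ^ 3 + 8 * T + 8) * \<xi>\<^sup>2"
        using T by (simp add: algebra_simps)
      finally have "(4 * T + 4) * (1 + \<xi>\<^sup>2) \<le> (4 * T ^ 3 + 8 * T + 8) * \<xi>\<^sup>2" .
      moreover have "1 + \<xi>\<^sup>2 > 0" "\<xi>\<^sup>2 > 0" using q by auto
      ultimately have "(4 * T + 4) / \<xi>\<^sup>2 \<le> (4 * T ^ 3 + 8 * T + 8) / (1 + \<xi>\<^sup>2)"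
        by (simp only: pos_divide_le_eq pos_le_divide_eq times_divide_eq_left)
      then show ?thesis by (simp add: add_divide_distrib)
    qed
    finally show ?thesis unfolding f_def .
  qed
qed

text \<open>The parabola exceeds the indicator of [-R, R], so the mean square may be integrated
  against it over [-T, T]. When the square is expanded, the pair (m, n) contributes the Fourier
  transform of the parabola at \<open>l m - l n\<close>; absolute values are taken only
  afterwards.\<close>

lemma nn_integral_trig_sum_le:
  fixes c :: "'a \<Rightarrow> complex" and l :: "'a \<Rightarrow> real"
  assumes A: "finite A" and R: "R \<ge> 0"
  defines "T \<equiv> R + 1"
  shows "(\<integral>\<^sup>+t\<in>{-R..R}. ennreal ((cmod (\<Sum>n\<in>A. c n * cis (l n * t)))\<^sup>2) \<partial>lborel)
    \<le> ennreal ((4 * T ^ 3 + 8 * T + 8) *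
         (\<Sum>m\<in>A. \<Sum>n\<in>A. cmod (c m) * cmod (c n) / (1 + (l m - l n)\<^sup>2)))"
proof -
  define P where "P = (\<lambda>t. \<Sum>n\<in>A. c n * cis (l n * t))"
  define k where "k = (\<lambda>\<xi> t. of_real (T\<^sup>2 - t\<^sup>2) * cis (\<xi> * t))"
  define K where "K = (\<lambda>\<xi>. integral {-T..T} (k \<xi>))"
  define S where "S = (\<Sum>m\<in>A. \<Sum>n\<in>A. c m * cnj (c n) * K (l m - l n))"
  have T: "T \<ge> 0" using R by (simp add: T_def)
  have k: "(k \<xi> has_integral K \<xi>) {-T..T}" for \<xi>
    unfolding K_def k_def
    by (intro integrable_integral integrable_continuous_interval continuous_intros)
  have "((\<lambda>t. \<Sum>m\<in>A. \<Sum>n\<in>A. c m * cnj (c n) * k (l m - l n) t) has_integral S) {-T..T}"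
    unfolding S_def by (intro has_integral_sum A has_integral_mult_right k)
  moreover have "(\<Sum>m\<in>A. \<Sum>n\<in>A. c m * cnj (c n) * k (l m - l n) t)
      = of_real ((T\<^sup>2 - t\<^sup>2) * (cmod (P t))\<^sup>2)" for t
  proof -
    have "of_real ((T\<^sup>2 - t\<^sup>2) * (cmod (P t))\<^sup>2) = of_real (T\<^sup>2 - t\<^sup>2) * (P t * cnj (P t))"
      by (simp only: of_real_mult complex_norm_square)
    also have "P t * cnj (P t) = (\<Sum>m\<in>A. \<Sum>n\<in>A. (c m * cis (l m * t)) * cnj (c n * cis (l n * t)))"
      unfolding P_def cnj_sum by (rule sum_product)
    also have "of_real (T\<^sup>2 - t\<^sup>2) * \<dots> = (\<Sum>m\<in>A. \<Sum>n\<in>A. c m * cnj (c n) * k (l m - l n) t)"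
      unfolding k_def sum_distrib_left
      by (intro sum.cong refl)
         (simp add: cis_cnj cis_mult[symmetric] cis_divide[symmetric] left_diff_distrib
           cis_inverse divide_inverse del: of_real_diff)
    finally show ?thesis by simp
  qed
  ultimately have "((\<lambda>t. complex_of_real ((T\<^sup>2 - t\<^sup>2) * (cmod (P t))\<^sup>2)) has_integral S) {-T..T}"
    by simp
  from has_integral_linear[OF this bounded_linear_Re]
  have I: "((\<lambda>t. (T\<^sup>2 - t\<^sup>2) * (cmod (P t))\<^sup>2) has_integral Re S) {-T..T}"
    by (simp only: o_def Re_complex_of_real)
  have le: "t\<^sup>2 \<le> T\<^sup>2" if "t \<in> {-T..T}" for t
    using that by (auto simp: abs_le_square_iff[symmetric])
  have "(\<integral>\<^sup>+t\<in>{-R..R}. ennreal ((cmod (P t))\<^sup>2) \<partial>lborel)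
      \<le> (\<integral>\<^sup>+t. ennreal (indicator {-T..T} t * ((T\<^sup>2 - t\<^sup>2) * (cmod (P t))\<^sup>2)) \<partial>lborel)"
  proof (rule nn_integral_mono)
    fix t
    show "ennreal ((cmod (P t))\<^sup>2) * indicator {-R..R} t
        \<le> ennreal (indicator {-T..T} t * ((T\<^sup>2 - t\<^sup>2) * (cmod (P t))\<^sup>2))"
    proof (cases "t \<in> {-R..R}")
      case True
      then have "t\<^sup>2 \<le> R\<^sup>2" by (auto simp: abs_le_square_iff[symmetric])
      \<comment> \<open>T^2 - R^2 = 2 R + 1; this is where the widening of the interval by 1 is
        used.\<close>
      then have "1 \<le> T\<^sup>2 - t\<^sup>2" using R by (simp add: T_def power2_eq_square algebra_simps)
      then have "(cmod (P t))\<^sup>2 \<le> (T\<^sup>2 - t\<^sup>2) * (cmod (P t))\<^sup>2"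
        using mult_right_mono[of 1 "T\<^sup>2 - t\<^sup>2" "(cmod (P t))\<^sup>2"] by simp
      moreover have "t \<in> {-T..T}" using True by (auto simp: T_def)
      ultimately show ?thesis using True by (simp add: ennreal_leI)
    qed simp
  qed
  also have "\<dots> = ennreal (Re S)"
    by (rule nn_integral_has_integral_lebesgue[OF _ I]) (use le in auto)
  also have "Re S \<le> (\<Sum>m\<in>A. \<Sum>n\<in>A. cmod (c m) * cmod (c n) * ((4 * T ^ 3 + 8 * T + 8) / (1 + (l m - l n)\<^sup>2)))"
  proof -
    have "Re S \<le> cmod S" by (rule complex_Re_le_cmod)
    also have "\<dots> \<le> (\<Sum>m\<in>A. \<Sum>n\<in>A. cmod (c m * cnj (c n) * K (l m - l n)))"
      unfolding S_def by (intro sum_norm_le order_refl)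
    also have "\<dots> \<le> (\<Sum>m\<in>A. \<Sum>n\<in>A. cmod (c m) * cmod (c n) * ((4 * T ^ 3 + 8 * T + 8) / (1 + (l m - l n)\<^sup>2)))"
      unfolding norm_mult complex_mod_cnj K_def k_def
      by (intro sum_mono mult_left_mono parabola_fourier_bound T) auto
    finally show ?thesis .
  qed
  also have "\<dots> = (4 * T ^ 3 + 8 * T + 8) *
      (\<Sum>m\<in>A. \<Sum>n\<in>A. cmod (c m) * cmod (c n) / (1 + (l m - l n)\<^sup>2))"
    unfolding sum_distrib_left by (intro sum.cong refl) (simp add: mult_ac)
  finally show ?thesis
    by (simp add: P_def ennreal_leI)
qed

subsection \<open>Dyadic blocks\<close>

abbreviation dyadic :: "nat \<Rightarrow> nat set" where
  "dyadic k \<equiv> {2 ^ k..<2 ^ Suc k}"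

lemma sum_dyadic:
  fixes f :: "nat \<Rightarrow> 'a :: comm_monoid_add"
  shows "(\<Sum>n\<in>{1..<2 ^ N}. f n) = (\<Sum>k<N. \<Sum>n\<in>dyadic k. f n)"
proof (induction N)
  case (Suc N)
  have "(\<Sum>n\<in>{1..<2 ^ Suc N}. f n) = (\<Sum>n\<in>{1..<2 ^ N}. f n) + (\<Sum>n\<in>dyadic N. f n)"
    by (rule sum.atLeastLessThan_concat[symmetric]) simp_all
  with Suc show ?case by simp
qed simp

lemma ln_dyadic:
  assumes "n \<in> dyadic k"
  shows "real k * ln 2 \<le> ln (real n)" "ln (real n) \<le> real (Suc k) * ln 2"
proof -
  have n: "0 < n" "2 ^ k \<le> real n" "real n \<le> 2 ^ Suc k"
    using assms of_nat_le_iff[of "2 ^ k" n, where 'a = real] of_nat_le_iff[of n "2 ^ Suc k", where 'a = real]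
    by (auto intro: less_le_trans[of 0 "2 ^ k"])
  have "ln (2 ^ k) \<le> ln (real n)" "ln (real n) \<le> ln (2 ^ Suc k)"
    using n by (subst ln_le_cancel_iff; simp)+
  then show "real k * ln 2 \<le> ln (real n)" "ln (real n) \<le> real (Suc k) * ln 2"
    by (simp_all only: ln_realpow zero_less_numeral)
qed

text \<open>Logarithms taken from blocks j and k differ by at least (|j - k| - 1) ln 2. Neighbouring
  blocks nearly touch, hence the loss of one unit, which the summand 1 on the right absorbs.\<close>

lemma dyadic_distance_le:
  assumes "m \<in> dyadic j" "n \<in> dyadic k"
  shows "1 + (real j - real k)\<^sup>2 \<le> 8 * (1 + (ln (real m) - ln (real n))\<^sup>2)"
proof -
  define d where "d = \<bar>real j - real k\<bar>"
  define x where "x = \<bar>ln (real m) - ln (real n)\<bar>"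
  have "(d - 1) * ln 2 \<le> x"
    using ln_dyadic[OF assms(1)] ln_dyadic[OF assms(2)]
    unfolding d_def x_def by (cases "j \<ge> k") (auto simp: algebra_simps)
  moreover have "1 / 2 \<le> ln (2 :: real)" using ln2_ge_two_thirds by simp
  ultimately have "d \<le> 2 * x + 1"
    using mult_left_mono[of "1 / 2" "ln 2" "d - 1"] by (cases "d \<ge> 1") (auto simp: x_def intro: order_trans[of d 1])
  then have "d\<^sup>2 \<le> (2 * x + 1)\<^sup>2" by (intro power_mono) (auto simp: d_def)
  \<comment> \<open>This says 4 x <= 4 x^2 + 1, which removes the linear term of (2 x +
    1)^2.\<close>
  moreover have "0 \<le> (2 * x - 1)\<^sup>2" by simp
  ultimately have "d\<^sup>2 \<le> 8 * x\<^sup>2 + 2"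
    by (simp add: power2_eq_square algebra_simps)
  then show ?thesis by (simp add: d_def x_def)
qed

text \<open>Each term is dominated by a telescoping difference; the terms up to k = j telescope in
  one direction, the later ones in the other. A bound independent of j and N is what Schur's test
  asks of the row sums.\<close>

lemma sum_inverse_square_distance_le:
  "(\<Sum>k<N. 1 / (1 + (real j - real k)\<^sup>2)) \<le> 8"
proof -
  have tele: "1 / (1 + d\<^sup>2) \<le> 4 * (1 / (d + 1) - 1 / (d + 2))" if "d \<ge> 0" for d :: real
  proof -
    \<comment> \<open>The difference of the two sides of the next inequality, 3 d^2 - 3 d + 2, with
      the square completed.\<close>
    have "0 \<le> 3 * (d - 1 / 2)\<^sup>2 + 5 / 4" by simp
    then have "(d + 1) * (d + 2) \<le> 4 * (1 + d\<^sup>2)"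
      by (simp add: power2_eq_square algebra_simps)
    then have "1 / (1 + d\<^sup>2) \<le> 4 / ((d + 1) * (d + 2))"
      using that by (simp add: frac_le_eq divide_simps add_pos_nonneg)
    also have "\<dots> = 4 * (1 / (d + 1) - 1 / (d + 2))"
      using that by (simp add: field_simps)
    finally show ?thesis .
  qed
  have left: "(\<Sum>k<M. 1 / (1 + (real j - real k)\<^sup>2)) \<le> 4 / (real j - real M + 2)"
    if "M \<le> Suc j" for M
    using that
  proof (induction M)
    case (Suc M)
    then show ?case using tele[of "real j - real M"] by (simp add: algebra_simps)
  qed simp
  have right: "(\<Sum>k<Suc j + M. 1 / (1 + (real j - real k)\<^sup>2)) \<le> 8 - 4 / (real M + 2)" for M
  proof (induction M)
    case 0
    then show ?case using left[of "Suc j"] by simp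
  next
    case (Suc M)
    then show ?case
      using tele[of "real M + 1"] by (simp add: power2_commute[of "real j"] algebra_simps)
  qed
  show ?thesis
  proof (cases "N \<le> Suc j")
    case True
    then have "4 / (real j - real N + 2) \<le> 4" by (simp add: divide_le_eq)
    then show ?thesis using left[OF True] by linarith
  next
    case False
    then obtain M where "N = Suc j + M" by (metis le_add_diff_inverse nat_le_linear)
    then show ?thesis using right[of M] by (smt (verit) divide_nonneg_nonneg of_nat_0_le_iff)
  qed
qed

text \<open>Schur's test: \<open>b j * b k\<close> is replaced by half the sum of the squares,
  symmetry of the kernel makes the two resulting double sums equal, and each row sum is at most
  8.\<close>

lemma schur_inverse_square:
  fixes b :: "nat \<Rightarrow> real"
  shows "(\<Sum>j<N. \<Sum>k<N. b j * b k / (1 + (real j - real k)\<^sup>2)) \<le> 8 * (\<Sum>j<N. (b j)\<^sup>2)"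
proof -
  define g where "g = (\<lambda>j k. 1 / (1 + (real j - real k)\<^sup>2))"
  have g: "g j k \<ge> 0" "g j k = g k j" for j k
    by (auto simp: g_def power2_commute add_pos_nonneg)
  have "(\<Sum>j<N. \<Sum>k<N. b j * b k * g j k)
      \<le> (\<Sum>j<N. \<Sum>k<N. ((b j)\<^sup>2 * g j k + (b k)\<^sup>2 * g k j) / 2)"
  proof (intro sum_mono)
    fix j k
    have "b j * b k \<le> ((b j)\<^sup>2 + (b k)\<^sup>2) / 2"
      using sum_squares_ge_zero[of "b j - b k" 0] by (simp add: power2_eq_square algebra_simps)
    from mult_right_mono[OF this g(1)[of j k]]
    show "b j * b k * g j k \<le> ((b j)\<^sup>2 * g j k + (b k)\<^sup>2 * g k j) / 2"
      by (simp add: g(2)[of k j] algebra_simps)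
  qed
  also have "\<dots> = ((\<Sum>j<N. \<Sum>k<N. (b j)\<^sup>2 * g j k) + (\<Sum>j<N. \<Sum>k<N. (b k)\<^sup>2 * g k j)) / 2"
    by (simp only: sum.distrib flip: sum_divide_distrib)
  also have "(\<Sum>j<N. \<Sum>k<N. (b k)\<^sup>2 * g k j) = (\<Sum>j<N. \<Sum>k<N. (b j)\<^sup>2 * g j k)"
    by (rule sum.swap)
  also have "(\<dots> + \<dots>) / 2 = (\<Sum>j<N. (b j)\<^sup>2 * (\<Sum>k<N. g j k))"
    by (simp flip: sum_distrib_left)
  also have "\<dots> \<le> (\<Sum>j<N. (b j)\<^sup>2 * 8)"
    unfolding g_def by (intro sum_mono mult_left_mono sum_inverse_square_distance_le) simp
  finally show ?thesis by (simp add: g_def sum_distrib_left mult.commute)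
qed

text \<open>Once logarithmic distance is replaced by block distance, the kernel is constant on each
  pair of blocks, so the inner double sum factors into two block sums. What remains is Schur's test
  in the block indices.\<close>

lemma nn_integral_log_freq_le:
  assumes R: "R \<ge> 0"
  shows "\<exists>C>0. \<forall>N c. (\<integral>\<^sup>+t\<in>{-R..R}. ennreal ((cmod (\<Sum>n\<in>{1..<2 ^ N}. c n * cis (- ln (real n) * t)))\<^sup>2) \<partial>lborel)
     \<le> ennreal (C * (\<Sum>k<N. (\<Sum>n\<in>dyadic k. cmod (c n))\<^sup>2))"
proof -
  define T where "T = R + 1"
  define D where "D = 4 * T ^ 3 + 8 * T + 8"
  have D: "D > 0" using R by (simp add: D_def T_def add_nonneg_nonneg add_pos_nonneg)
  have "(\<integral>\<^sup>+t\<in>{-R..R}. ennreal ((cmod (\<Sum>n\<in>{1..<2 ^ N}. c n * cis (- ln (real n) * t)))\<^sup>2) \<partial>lborel)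
     \<le> ennreal (64 * D * (\<Sum>k<N. (\<Sum>n\<in>dyadic k. cmod (c n))\<^sup>2))" for N and c :: "nat \<Rightarrow> complex"
  proof -
    define b where "b = (\<lambda>k. \<Sum>n\<in>dyadic k. cmod (c n))"
    let ?g = "\<lambda>m n. cmod (c m) * cmod (c n) / (1 + (- ln (real m) - - ln (real n))\<^sup>2)"
    have "(\<Sum>m\<in>{1..<2 ^ N}. \<Sum>n\<in>{1..<2 ^ N}. ?g m n)
        = (\<Sum>j<N. \<Sum>m\<in>dyadic j. \<Sum>k<N. \<Sum>n\<in>dyadic k. ?g m n)"
      by (simp only: sum_dyadic)
    also have "\<dots> = (\<Sum>j<N. \<Sum>k<N. \<Sum>m\<in>dyadic j. \<Sum>n\<in>dyadic k. ?g m n)"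
      by (intro sum.cong refl sum.swap)
    also have "\<dots> \<le> (\<Sum>j<N. \<Sum>k<N. \<Sum>m\<in>dyadic j. \<Sum>n\<in>dyadic k.
        8 * (cmod (c m) * cmod (c n) / (1 + (real j - real k)\<^sup>2)))"
    proof (intro sum_mono)
      fix j k m n
      assume mn: "m \<in> dyadic j" "n \<in> dyadic k"
      define p where "p = 1 + (real j - real k)\<^sup>2"
      define q where "q = 1 + (- ln (real m) - - ln (real n))\<^sup>2"
      have pq: "p > 0" "q > 0" "p \<le> 8 * q"
        using dyadic_distance_le[OF mn]
        by (auto simp: p_def q_def add_pos_nonneg power2_commute[of "ln (real m)"])
      then have "1 / q \<le> 8 / p" by (simp add: field_simps)
      from mult_left_mono[OF this, of "cmod (c m) * cmod (c n)"]
      show "?g m n \<le> 8 * (cmod (c m) * cmod (c n) / (1 + (real j - real k)\<^sup>2))"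
        by (simp add: p_def q_def mult_ac)
    qed
    also have "\<dots> = 8 * (\<Sum>j<N. \<Sum>k<N. b j * b k / (1 + (real j - real k)\<^sup>2))"
      unfolding b_def sum_product sum_divide_distrib by (simp only: sum_distrib_left)
    \<comment> \<open>One factor 8 stems from the distance comparison, the other from Schur's
      test.\<close>
    also have "\<dots> \<le> 8 * (8 * (\<Sum>j<N. (b j)\<^sup>2))"
      by (intro mult_left_mono schur_inverse_square) simp
    finally have le: "(\<Sum>m\<in>{1..<2 ^ N}. \<Sum>n\<in>{1..<2 ^ N}. ?g m n) \<le> 64 * (\<Sum>j<N. (b j)\<^sup>2)"
      by simp
    have "D * (\<Sum>m\<in>{1..<2 ^ N}. \<Sum>n\<in>{1..<2 ^ N}. ?g m n) \<le> 64 * D * (\<Sum>j<N. (b j)\<^sup>2)"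
      using mult_left_mono[OF le less_imp_le[OF D]] by (simp only: mult.assoc mult.left_commute[of D 64])
    then show ?thesis
      unfolding b_def D_def T_def
      by - (intro order_trans[OF nn_integral_trig_sum_le[OF finite_atLeastLessThan R]] ennreal_leI)
  qed
  then show ?thesis using D by (intro exI[of _ "64 * D"]) auto
qed

section \<open>Weighted Cauchy-Schwarz and a Gamma integral\<close>

lemma square_sum_le_weighted:
  fixes w :: "'a \<Rightarrow> real" and a :: "'a \<Rightarrow> complex"
  assumes w: "\<And>n. n \<in> A \<Longrightarrow> w n \<ge> 0" and a: "\<And>n. n \<in> A \<Longrightarrow> w n = 0 \<Longrightarrow> a n = 0"
  shows "(\<Sum>n\<in>A. cmod (a n))\<^sup>2 \<le> (\<Sum>n\<in>A. (cmod (a n))\<^sup>2 / w n) * (\<Sum>n\<in>A. w n)"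
proof -
  \<comment> \<open>Where \<open>w n\<close> vanishes so does \<open>a n\<close>, and division by
    zero yields 0, so the summands agree there too.\<close>
  have "(\<Sum>n\<in>A. cmod (a n)) = (\<Sum>n\<in>A. (cmod (a n) / sqrt (w n)) * sqrt (w n))"
    using a by (intro sum.cong) auto
  also have "\<dots>\<^sup>2 \<le> (\<Sum>n\<in>A. (cmod (a n) / sqrt (w n))\<^sup>2) * (\<Sum>n\<in>A. (sqrt (w n))\<^sup>2)"
    by (rule Cauchy_Schwarz_ineq_sum)
  also have "\<dots> = (\<Sum>n\<in>A. (cmod (a n))\<^sup>2 / w n) * (\<Sum>n\<in>A. w n)"
    using w by (simp add: power_divide)
  finally show ?thesis .
qed

text \<open>A shift by 1/2 and an exponential majorant turn this into a Gamma integral at scale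
  \<open>Suc k\<close>; using \<open>Suc k\<close> for k keeps the power meaningful on the block k =
  0. The condition on \<open>\<beta>\<close> is integrability at \<sigma> = 1/2.\<close>

lemma nn_integral_powr_exp_le:
  fixes \<beta> :: real
  assumes \<beta>: "\<beta> > -1"
  shows "\<exists>C>0. \<forall>k. (\<integral>\<^sup>+\<sigma>\<in>{1 / 2<..1}. ennreal ((\<sigma> - 1 / 2) powr \<beta> * 2 powr (- 2 * real k * \<sigma>)) \<partial>lborel)
      \<le> ennreal (C * (2 powr (- real k) * real (Suc k) powr (- \<beta> - 1)))"
proof -
  define G where "G = Gamma (\<beta> + 1)"
  have G: "G > 0" using \<beta> by (simp add: G_def Gamma_real_pos)
  have "(\<integral>\<^sup>+\<sigma>\<in>{1 / 2<..1}. ennreal ((\<sigma> - 1 / 2) powr \<beta> * 2 powr (- 2 * real k * \<sigma>)) \<partial>lborel)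
      \<le> ennreal (exp 1 * G * (2 powr (- real k) * real (Suc k) powr (- \<beta> - 1)))" for k
  proof -
    define L where "L = real (Suc k)"
    have L: "L > 0" by (simp add: L_def)
    define D where "D = exp 1 * 2 powr (- real k) * L powr (- \<beta>)"
    have D: "D > 0" using L by (simp add: D_def)
    define h where "h = (\<lambda>t::real. ennreal (indicator {0..} t * t powr \<beta> / exp t))"
    have [measurable]: "h \<in> borel_measurable borel" unfolding h_def by measurable
    have "(\<integral>\<^sup>+\<sigma>\<in>{1 / 2<..1}. ennreal ((\<sigma> - 1 / 2) powr \<beta> * 2 powr (- 2 * real k * \<sigma>)) \<partial>lborel)
        = (\<integral>\<^sup>+x. ennreal ((1 / 2 + 1 * x - 1 / 2) powr \<beta> * 2 powr (- 2 * real k * (1 / 2 + 1 * x)))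
              * indicator {1 / 2<..1} (1 / 2 + 1 * x) \<partial>lborel)"
      by (subst nn_integral_real_affine[of _ 1 "1 / 2"]) simp_all
    also have "\<dots> \<le> (\<integral>\<^sup>+x. ennreal D * h (0 + L * x) \<partial>lborel)"
    proof (rule nn_integral_mono)
      fix x :: real
      show "ennreal ((1 / 2 + 1 * x - 1 / 2) powr \<beta> * 2 powr (- 2 * real k * (1 / 2 + 1 * x)))
              * indicator {1 / 2<..1} (1 / 2 + 1 * x) \<le> ennreal D * h (0 + L * x)"
      proof (cases "0 < x \<and> x \<le> 1 / 2")
        case True
        have "2 powr (- 2 * real k * (1 / 2 + 1 * x)) = 2 powr (- real k) * exp (- (2 * ln 2 * (k * x)))"
          by (simp add: powr_def algebra_simps flip: exp_add)
        \<comment> \<open>Here 2 ln 2 >= 1 and k x = L x - x with x <= 1, so replacing k by L costs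
          at most the factor e.\<close>
        also have "exp (- (2 * ln 2 * (k * x))) \<le> exp (1 - L * x)"
        proof -
          have "1 * (k * x) \<le> 2 * ln 2 * (k * x)"
            using True ln2_ge_two_thirds by (intro mult_right_mono) auto
          moreover have "L * x = x + k * x" by (simp add: L_def algebra_simps)
          ultimately show ?thesis using True unfolding exp_le_cancel_iff by linarith
        qed
        finally have "2 powr (- 2 * real k * (1 / 2 + 1 * x)) \<le> 2 powr (- real k) * (exp 1 / exp (L * x))"
          by (simp add: exp_diff)
        then have "x powr \<beta> * 2 powr (- 2 * real k * (1 / 2 + 1 * x))
            \<le> x powr \<beta> * (2 powr (- real k) * (exp 1 / exp (L * x)))"
          by (rule mult_left_mono) simp
        also have "\<dots> = D * ((L * x) powr \<beta> / exp (L * x))"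
          using L True by (simp add: D_def powr_mult powr_minus)
        finally have "x powr \<beta> * 2 powr (- 2 * real k * (1 / 2 + 1 * x)) \<le> D * ((L * x) powr \<beta> / exp (L * x))" .
        then have "ennreal (x powr \<beta> * 2 powr (- 2 * real k * (1 / 2 + 1 * x)))
            \<le> ennreal D * ennreal ((L * x) powr \<beta> / exp (L * x))"
          using D by (simp flip: ennreal_mult' add: ennreal_leI)
        then show ?thesis using True L by (simp add: h_def)
      qed (auto simp: indicator_def)
    qed
    also have "\<dots> = ennreal D * (\<integral>\<^sup>+x. h (0 + L * x) \<partial>lborel)"
      by (rule nn_integral_cmult) measurable
    also have "(\<integral>\<^sup>+x. h (0 + L * x) \<partial>lborel) = ennreal (G / L)"
    proof -
      have "ennreal G = ennreal L * (\<integral>\<^sup>+x. h (0 + L * x) \<partial>lborel)"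
        using nn_integral_real_affine[of h L 0] L Gamma_conv_nn_integral_real[of "\<beta> + 1"] \<beta>
        by (simp add: G_def h_def)
      then have "ennreal (1 / L) * ennreal G = (ennreal (1 / L) * ennreal L) * (\<integral>\<^sup>+x. h (0 + L * x) \<partial>lborel)"
        by (simp add: mult.assoc)
      then show ?thesis using L G by (simp flip: ennreal_mult')
    qed
    also have "ennreal D * ennreal (G / L) = ennreal (D * (G / L))"
      using D by (simp only: ennreal_mult' less_imp_le)
    also have "D * (G / L) = exp 1 * G * (2 powr (- real k) * L powr (- \<beta> - 1))"
      using L by (simp add: D_def powr_diff)
    finally show ?thesis by (simp add: L_def)
  qed
  then show ?thesis using G by (intro exI[of _ "exp 1 * G"]) auto
qed

lemma of_nat_powr_Complex:
  assumes "n > 0"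
  shows "of_nat n powr (- Complex \<sigma> t) = of_real (real n powr (- \<sigma>)) * cis (- ln (real n) * t)"
proof -
  have "of_nat n powr (- Complex \<sigma> t) = exp (- Complex \<sigma> t * of_real (ln (real n)))"
    using assms by (simp add: powr_def Ln_of_nat)
  also have "\<dots> = exp (of_real (- \<sigma> * ln (real n)) + \<i> * of_real (- ln (real n) * t))"
    by (simp add: Complex_eq algebra_simps)
  also have "\<dots> = of_real (real n powr (- \<sigma>)) * cis (- ln (real n) * t)"
    using assms by (simp only: exp_add cis_conv_exp powr_def exp_of_real) simp
  finally show ?thesis .
qed

lemma norm_of_nat_powr:
  assumes "n > 0"
  shows "cmod (of_nat n powr (- s)) = real n powr (- Re s)"
  using of_nat_powr_Complex[OF assms, of "Re s" "Im s"] by (simp add: norm_mult)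

subsection \<open>Energy of partial sums\<close>

text \<open>Fatou's lemma in the form that carries a uniform bound from partial sums to the
  series.\<close>

lemma nn_integral_le_of_tendsto:
  fixes f :: "'a \<Rightarrow> ennreal"
  assumes u: "\<And>N. u N \<in> borel_measurable M"
    and lim: "\<And>x. x \<in> space M \<Longrightarrow> (\<lambda>N. u N x) \<longlonglongrightarrow> f x"
    and le: "\<And>N. (\<integral>\<^sup>+x. u N x \<partial>M) \<le> B"
  shows "(\<integral>\<^sup>+x. f x \<partial>M) \<le> B"
proof -
  have "(\<integral>\<^sup>+x. f x \<partial>M) = (\<integral>\<^sup>+x. liminf (\<lambda>N. u N x) \<partial>M)"
    by (intro nn_integral_cong lim_imp_Liminf[symmetric] lim) simp_all
  also have "\<dots> \<le> liminf (\<lambda>N. \<integral>\<^sup>+x. u N x \<partial>M)"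
    by (intro nn_integral_liminf u)
  also have "\<dots> \<le> B"
    using Liminf_mono[of "\<lambda>N. \<integral>\<^sup>+x. u N x \<partial>M" "\<lambda>_. B" sequentially] le by (simp add: Liminf_const)
  finally show ?thesis .
qed

text \<open>Cutting at a power of 2 makes every partial sum a union of complete dyadic blocks. The
  index is n itself, whereas \<open>dirichlet_term\<close> is shifted by one.\<close>

definition dyadic_partial_sum :: "nat \<Rightarrow> (nat \<Rightarrow> complex) \<Rightarrow> complex \<Rightarrow> complex" where
  "dyadic_partial_sum N c s = (\<Sum>n\<in>{1..<2 ^ N}. c n * of_nat n powr (- s))"

lemma continuous_dyadic_partial_sum: "continuous_on A (dyadic_partial_sum N c)"
  unfolding dyadic_partial_sum_def by (auto intro!: continuous_intros)

lemma measurable_dyadic_partial_sum [measurable]: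
  "dyadic_partial_sum N c \<in> borel_measurable borel"
  by (intro borel_measurable_continuous_onI continuous_dyadic_partial_sum)

lemma measurable_dyadic_partial_sum_line [measurable]:
  "(\<lambda>t. dyadic_partial_sum N c (Complex \<sigma> t)) \<in> borel_measurable borel"
  unfolding dyadic_partial_sum_def Complex_eq
  by (intro borel_measurable_continuous_onI) (auto intro!: continuous_intros)

lemma measurable_strip [measurable]: "strip {-R..R} \<in> sets borel"
  unfolding strip_def by measurable

text \<open>On a vertical line the modulus of the n-th power goes into the coefficient and its phase
  has frequency -ln n. The constant depends on R only and so serves all lines at once.\<close>

lemma nn_integral_dyadic_partial_sum_line:
  assumes R: "R \<ge> 0"
  shows "\<exists>C>0. \<forall>N c \<sigma>. (\<integral>\<^sup>+t\<in>{-R..R}. ennreal ((cmod (dyadic_partial_sum N c (Complex \<sigma> t)))\<^sup>2) \<partial>lborel)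
     \<le> ennreal (C * (\<Sum>k<N. (\<Sum>n\<in>dyadic k. cmod (c n) * real n powr (- \<sigma>))\<^sup>2))"
proof -
  obtain C where C: "C > 0" and le: "\<And>N c. (\<integral>\<^sup>+t\<in>{-R..R}. ennreal ((cmod (\<Sum>n\<in>{1..<2 ^ N}. c n * cis (- ln (real n) * t)))\<^sup>2) \<partial>lborel)
     \<le> ennreal (C * (\<Sum>k<N. (\<Sum>n\<in>dyadic k. cmod (c n))\<^sup>2))"
    using nn_integral_log_freq_le[OF R] by auto
  have "dyadic_partial_sum N c (Complex \<sigma> t)
      = (\<Sum>n\<in>{1..<2 ^ N}. (c n * of_real (real n powr (- \<sigma>))) * cis (- ln (real n) * t))" for N c \<sigma> t
    unfolding dyadic_partial_sum_def
    by (intro sum.cong refl) (subst of_nat_powr_Complex; simp add: mult.assoc)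
  then have "(\<integral>\<^sup>+t\<in>{-R..R}. ennreal ((cmod (dyadic_partial_sum N c (Complex \<sigma> t)))\<^sup>2) \<partial>lborel)
     \<le> ennreal (C * (\<Sum>k<N. (\<Sum>n\<in>dyadic k. cmod (c n) * real n powr (- \<sigma>))\<^sup>2))" for N c \<sigma>
    using le[where N = N and c = "\<lambda>n. c n * of_real (real n powr (- \<sigma>))"] by (simp add: norm_mult)
  with C show ?thesis by blast
qed

lemma sum_Suc_pow2: "(\<Sum>n<2 ^ N - 1. f (Suc n)) = (\<Sum>n\<in>{1..<2 ^ N}. f n)"
  for f :: "nat \<Rightarrow> 'b :: comm_monoid_add"
proof -
  have "{1..<2 ^ N} = {Suc 0..<Suc (2 ^ N - 1)}" by simp
  then show ?thesis
    by (simp only: sum.atLeast_Suc_lessThan_Suc_shift) (simp add: lessThan_atLeast0)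
qed

section \<open>Weights bounded on dyadic blocks\<close>

text \<open>The coefficient bound localised to one block, with \<open>Suc k\<close> in the role of
  ln n; unlike ln n it is positive also on the block k = 0, which consists of n = 1.\<close>

locale dyadic_weight =
  fixes w :: "nat \<Rightarrow> real" and \<alpha> W :: real
  assumes w_nonneg: "\<And>n. n \<ge> 1 \<Longrightarrow> w n \<ge> 0"
    and W_pos: "W > 0"
    and w_dyadic: "\<And>k. (\<Sum>n\<in>dyadic k. w n) \<le> W * (2 ^ k * real (Suc k) powr (- \<alpha>))"
begin

definition energy :: "(nat \<Rightarrow> complex) \<Rightarrow> nat \<Rightarrow> real" where
  "energy a k = (\<Sum>n\<in>dyadic k. (cmod (a n))\<^sup>2 / w n)"

lemma dyadic_pos: "n \<in> dyadic k \<Longrightarrow> n \<ge> 1"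
  using order_trans[of 1 "2 ^ k" n] by simp

lemma energy_nonneg: "energy a k \<ge> 0"
  unfolding energy_def by (intro sum_nonneg divide_nonneg_nonneg w_nonneg dyadic_pos) simp_all

lemma sum_energy_le:
  assumes "a \<in> H_space w"
  shows "(\<Sum>k<N. energy a k) \<le> H_norm_sq w a"
proof -
  have "(\<Sum>k<N. energy a k) = (\<Sum>n<2 ^ N - 1. (cmod (a (Suc n)))\<^sup>2 / w (Suc n))"
    by (simp only: energy_def sum_Suc_pow2[of "\<lambda>n. (cmod (a n))\<^sup>2 / w n"] sum_dyadic)
  also have "\<dots> \<le> H_norm_sq w a"
    using assms w_nonneg unfolding H_norm_sq_def H_space_def
    by (intro sum_le_suminf) auto
  finally show ?thesis .
qed

text \<open>The exponent \<open>e\<close> treats two series at once: e = 0 is the series itself, e =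
  1 its derivative, whose coefficients gain a factor ln n. The decay in n is frozen at the left end
  of the block, and Cauchy-Schwarz splits the rest into the block's share of the norm and its total
  weight.\<close>

lemma dyadic_block_le:
  assumes a: "a \<in> H_space w" and \<sigma>: "\<sigma> \<ge> 0"
    and c: "\<And>n. n \<in> dyadic k \<Longrightarrow> cmod (c n) \<le> cmod (a n) * real (Suc k) powr e"
  shows "(\<Sum>n\<in>dyadic k. cmod (c n) * real n powr (- \<sigma>))\<^sup>2
      \<le> energy a k * (W * (2 powr real k * real (Suc k) powr (2 * e - \<alpha>) * 2 powr (- 2 * real k * \<sigma>)))"
proof -
  define x where "x = real (Suc k) powr e * 2 powr (- real k * \<sigma>)"
  have "(\<Sum>n\<in>dyadic k. cmod (c n) * real n powr (- \<sigma>)) \<le> (\<Sum>n\<in>dyadic k. cmod (a n) * x)"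
  proof (rule sum_mono)
    fix n assume n: "n \<in> dyadic k"
    then have "2 powr real k \<le> real n"
      using of_nat_le_iff[of "2 ^ k" n, where 'a = real] by (simp add: powr_realpow)
    then have "real n powr (- \<sigma>) \<le> (2 powr real k) powr (- \<sigma>)"
      using \<sigma> by (intro powr_mono2') auto
    also have "\<dots> = 2 powr (- real k * \<sigma>)" by (simp add: powr_powr)
    finally have "cmod (c n) * real n powr (- \<sigma>) \<le> (cmod (a n) * real (Suc k) powr e) * 2 powr (- real k * \<sigma>)"
      using c[OF n] by (intro mult_mono) auto
    then show "cmod (c n) * real n powr (- \<sigma>) \<le> cmod (a n) * x"
      by (simp add: x_def mult_ac)
  qed
  then have "(\<Sum>n\<in>dyadic k. cmod (c n) * real n powr (- \<sigma>))\<^sup>2 \<le> (\<Sum>n\<in>dyadic k. cmod (a n) * x)\<^sup>2"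
    by (intro power_mono sum_nonneg) auto
  also have "\<dots> = (\<Sum>n\<in>dyadic k. cmod (a n))\<^sup>2 * x\<^sup>2"
    by (simp only: power_mult_distrib flip: sum_distrib_right)
  also have "\<dots> \<le> (energy a k * (\<Sum>n\<in>dyadic k. w n)) * x\<^sup>2"
  proof (intro mult_right_mono)
    show "(\<Sum>n\<in>dyadic k. cmod (a n))\<^sup>2 \<le> energy a k * (\<Sum>n\<in>dyadic k. w n)"
      unfolding energy_def
    proof (rule square_sum_le_weighted)
      fix n assume "n \<in> dyadic k"
      then have n: "n \<ge> 1" by (rule dyadic_pos)
      then show "w n \<ge> 0" by (rule w_nonneg)
      show "a n = 0" if "w n = 0"
        using a n that unfolding H_space_def by (cases n) auto
    qed
  qed simp
  also have "\<dots> \<le> (energy a k * (W * (2 ^ k * real (Suc k) powr (- \<alpha>)))) * x\<^sup>2"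
    by (intro mult_right_mono mult_left_mono w_dyadic energy_nonneg) simp
  also have "\<dots> = energy a k * (W * (2 powr real k * real (Suc k) powr (2 * e - \<alpha>) * 2 powr (- 2 * real k * \<sigma>)))"
  proof -
    have "x\<^sup>2 = real (Suc k) powr (2 * e) * 2 powr (- 2 * real k * \<sigma>)"
      by (simp only: x_def power_mult_distrib) (simp add: power2_eq_square mult_ac flip: powr_add)
    moreover have "real (Suc k) powr (2 * e - \<alpha>) = real (Suc k) powr (- \<alpha>) * real (Suc k) powr (2 * e)"
      by (simp only: powr_add[symmetric]) simp
    ultimately show ?thesis by (simp only: powr_realpow zero_less_numeral mult_ac)
  qed
  finally show ?thesis .
qed

text \<open>For \<alpha> = 0 the block factor is 2^(k (1 - 2 \<sigma>)), at most 1 to the right of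
  1/2, so the bound is uniform in \<sigma>.\<close>

lemma line_bound:
  assumes R: "R \<ge> 0" and \<alpha>: "\<alpha> = 0"
  shows "\<exists>C>0. \<forall>N. \<forall>a\<in>H_space w. \<forall>\<sigma>>1/2.
    (\<integral>\<^sup>+t\<in>{-R..R}. ennreal ((cmod (dyadic_partial_sum N a (Complex \<sigma> t)))\<^sup>2) \<partial>lborel)
      \<le> ennreal (C * H_norm_sq w a)"
proof -
  obtain C where C: "C > 0" and le: "\<And>N c \<sigma>. (\<integral>\<^sup>+t\<in>{-R..R}. ennreal ((cmod (dyadic_partial_sum N c (Complex \<sigma> t)))\<^sup>2) \<partial>lborel)
     \<le> ennreal (C * (\<Sum>k<N. (\<Sum>n\<in>dyadic k. cmod (c n) * real n powr (- \<sigma>))\<^sup>2))"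
    using nn_integral_dyadic_partial_sum_line[OF R] by auto
  have "(\<integral>\<^sup>+t\<in>{-R..R}. ennreal ((cmod (dyadic_partial_sum N a (Complex \<sigma> t)))\<^sup>2) \<partial>lborel)
      \<le> ennreal (C * W * H_norm_sq w a)" if a: "a \<in> H_space w" and \<sigma>: "\<sigma> > 1/2" for N a \<sigma>
  proof -
    have "(\<Sum>k<N. (\<Sum>n\<in>dyadic k. cmod (a n) * real n powr (- \<sigma>))\<^sup>2) \<le> (\<Sum>k<N. energy a k * W)"
    proof (rule sum_mono)
      fix k
      have "(\<Sum>n\<in>dyadic k. cmod (a n) * real n powr (- \<sigma>))\<^sup>2
        \<le> energy a k * (W * (2 powr real k * real (Suc k) powr (2 * 0 - \<alpha>) * 2 powr (- 2 * real k * \<sigma>)))"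
        using \<sigma> by (intro dyadic_block_le a) auto
      also have "\<dots> = energy a k * (W * 2 powr (real k * (1 - 2 * \<sigma>)))"
        by (simp add: \<alpha> algebra_simps flip: powr_add)
      also have "\<dots> \<le> energy a k * (W * 1)"
        using \<sigma> W_pos energy_nonneg[of a k] powr_mono[of "real k * (1 - 2 * \<sigma>)" 0 2]
        by (intro mult_left_mono) (auto simp: mult_le_0_iff)
      finally show "(\<Sum>n\<in>dyadic k. cmod (a n) * real n powr (- \<sigma>))\<^sup>2 \<le> energy a k * W" by simp
    qed
    also have "\<dots> = W * (\<Sum>k<N. energy a k)" by (simp only: mult.commute sum_distrib_left)
    also have "\<dots> \<le> W * H_norm_sq w a"
      using W_pos by (intro mult_left_mono sum_energy_le a) simp
    finally show ?thesis
      using C by (intro order_trans[OF le] ennreal_leI) (simp add: mult.assoc)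
  qed
  then show ?thesis using C W_pos by (intro exI[of _ "C * W"]) auto
qed

text \<open>The relation for \<open>\<beta>\<close> makes all powers cancel: on block k the weights
  contribute \<open>Suc k\<close> to the power 2 e - \<alpha>, integration in \<sigma> contributes
  the power -\<beta> - 1 = \<alpha> - 2 e, and 2^k meets 2^(-k). A constant times
  \<open>energy a k\<close> is left, and these energies sum to at most the norm.\<close>

lemma strip_bound:
  assumes R: "R \<ge> 0" and \<beta>: "\<beta> = 2 * e - \<alpha> - 1" "\<beta> > -1"
  shows "\<exists>C>0. \<forall>N. \<forall>a\<in>H_space w. \<forall>c.
    (\<forall>k. \<forall>n\<in>dyadic k. cmod (c n) \<le> cmod (a n) * real (Suc k) powr e) \<longrightarrow>
    (\<integral>\<^sup>+s\<in>strip {-R..R}. ennreal ((cmod (dyadic_partial_sum N c s))\<^sup>2 * (Re s - 1 / 2) powr \<beta>) \<partial>lborel)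
      \<le> ennreal (C * H_norm_sq w a)"
proof -
  obtain C where C: "C > 0" and le: "\<And>N c \<sigma>. (\<integral>\<^sup>+t\<in>{-R..R}. ennreal ((cmod (dyadic_partial_sum N c (Complex \<sigma> t)))\<^sup>2) \<partial>lborel)
     \<le> ennreal (C * (\<Sum>k<N. (\<Sum>n\<in>dyadic k. cmod (c n) * real n powr (- \<sigma>))\<^sup>2))"
    using nn_integral_dyadic_partial_sum_line[OF R] by auto
  obtain G where G: "G > 0" and Gle: "\<And>k. (\<integral>\<^sup>+\<sigma>\<in>{1 / 2<..1}. ennreal ((\<sigma> - 1 / 2) powr \<beta> * 2 powr (- 2 * real k * \<sigma>)) \<partial>lborel)
      \<le> ennreal (G * (2 powr (- real k) * real (Suc k) powr (- \<beta> - 1)))"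
    using nn_integral_powr_exp_le[OF \<beta>(2)] by auto
  have "(\<integral>\<^sup>+s\<in>strip {-R..R}. ennreal ((cmod (dyadic_partial_sum N c s))\<^sup>2 * (Re s - 1 / 2) powr \<beta>) \<partial>lborel)
      \<le> ennreal (C * W * G * H_norm_sq w a)"
    if a: "a \<in> H_space w" and c: "\<And>k n. n \<in> dyadic k \<Longrightarrow> cmod (c n) \<le> cmod (a n) * real (Suc k) powr e" for N a c
  proof -
    \<comment> \<open>\<open>q k\<close> collects what does not depend on \<sigma>, and
      \<open>g k\<close> below is the integrand in \<sigma>; the strip integral thus reduces to a
      finite sum of one-dimensional integrals.\<close>
    define q where "q = (\<lambda>k. C * energy a k * W * (2 powr real k * real (Suc k) powr (2 * e - \<alpha>)))"
    have q: "q k \<ge> 0" for k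
      using C W_pos energy_nonneg[of a k] by (simp add: q_def)
    define g where "g = (\<lambda>k \<sigma>. ennreal ((\<sigma> - 1 / 2) powr \<beta> * 2 powr (- 2 * real k * \<sigma>)) * indicator {1 / 2<..1} \<sigma>)"
    have [measurable]: "g k \<in> borel_measurable borel" for k unfolding g_def by measurable
    have "(\<integral>\<^sup>+s\<in>strip {-R..R}. ennreal ((cmod (dyadic_partial_sum N c s))\<^sup>2 * (Re s - 1 / 2) powr \<beta>) \<partial>lborel)
      = (\<integral>\<^sup>+\<sigma>. \<integral>\<^sup>+t. ennreal ((cmod (dyadic_partial_sum N c (Complex \<sigma> t)))\<^sup>2 * (\<sigma> - 1 / 2) powr \<beta>)
            * indicator (strip {-R..R}) (Complex \<sigma> t) \<partial>lborel \<partial>lborel)"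
      by (subst nn_integral_lborel_complex) simp_all
    also have "\<dots> \<le> (\<integral>\<^sup>+\<sigma>. (\<Sum>k<N. ennreal (q k) * g k \<sigma>) \<partial>lborel)"
    proof (rule nn_integral_mono)
      fix \<sigma> :: real
      show "(\<integral>\<^sup>+t. ennreal ((cmod (dyadic_partial_sum N c (Complex \<sigma> t)))\<^sup>2 * (\<sigma> - 1 / 2) powr \<beta>)
            * indicator (strip {-R..R}) (Complex \<sigma> t) \<partial>lborel) \<le> (\<Sum>k<N. ennreal (q k) * g k \<sigma>)"
      proof (cases "\<sigma> \<in> {1 / 2<..1}")
        case True
        define p where "p = (\<sigma> - 1 / 2) powr \<beta>"
        have p: "p \<ge> 0" by (simp add: p_def)
        have "(\<integral>\<^sup>+t. ennreal ((cmod (dyadic_partial_sum N c (Complex \<sigma> t)))\<^sup>2 * p)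
            * indicator (strip {-R..R}) (Complex \<sigma> t) \<partial>lborel)
          = (\<integral>\<^sup>+t. ennreal p * (ennreal ((cmod (dyadic_partial_sum N c (Complex \<sigma> t)))\<^sup>2) * indicator {-R..R} t) \<partial>lborel)"
          using True p by (intro nn_integral_cong) (auto simp: strip_def indicator_def ennreal_mult' mult_ac)
        also have "\<dots> = ennreal p * (\<integral>\<^sup>+t\<in>{-R..R}. ennreal ((cmod (dyadic_partial_sum N c (Complex \<sigma> t)))\<^sup>2) \<partial>lborel)"
          by (rule nn_integral_cmult) measurable
        also have "\<dots> \<le> ennreal p * ennreal (C * (\<Sum>k<N. (\<Sum>n\<in>dyadic k. cmod (c n) * real n powr (- \<sigma>))\<^sup>2))"
          by (intro mult_left_mono le) simp
        also have "\<dots> = ennreal (p * (C * (\<Sum>k<N. (\<Sum>n\<in>dyadic k. cmod (c n) * real n powr (- \<sigma>))\<^sup>2)))"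
          using p by (simp add: ennreal_mult')
        also have "\<dots> \<le> ennreal (p * (C * (\<Sum>k<N. energy a k * (W * (2 powr real k * real (Suc k) powr (2 * e - \<alpha>) * 2 powr (- 2 * real k * \<sigma>))))))"
          using p C True by (intro ennreal_leI mult_left_mono sum_mono dyadic_block_le[OF a _ c]) auto
        also have "\<dots> = ennreal (\<Sum>k<N. q k * (p * 2 powr (- 2 * real k * \<sigma>)))"
          unfolding sum_distrib_left q_def by (intro arg_cong[of _ _ ennreal] sum.cong refl) (simp only: mult_ac)
        also have "\<dots> = (\<Sum>k<N. ennreal (q k * (p * 2 powr (- 2 * real k * \<sigma>))))"
          using q p by (intro sum_ennreal[symmetric]) simp
        also have "\<dots> = (\<Sum>k<N. ennreal (q k) * g k \<sigma>)"
          using q True by (intro sum.cong refl) (simp add: g_def p_def ennreal_mult')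
        finally show ?thesis by (simp add: p_def)
      next
        case False
        then have "indicator (strip {-R..R}) (Complex \<sigma> t) = (0 :: ennreal)" for t
          by (auto simp: strip_def indicator_def)
        then show ?thesis by simp
      qed
    qed
    also have "\<dots> = (\<Sum>k<N. ennreal (q k) * (\<integral>\<^sup>+\<sigma>. g k \<sigma> \<partial>lborel))"
      by (subst nn_integral_sum) (simp_all add: nn_integral_cmult)
    also have "\<dots> \<le> (\<Sum>k<N. ennreal (q k) * ennreal (G * (2 powr (- real k) * real (Suc k) powr (- \<beta> - 1))))"
      unfolding g_def by (intro sum_mono mult_left_mono Gle) simp
    also have "\<dots> = (\<Sum>k<N. ennreal (C * W * G * energy a k))"
    proof (intro sum.cong refl)
      fix k
      have "2 powr real k * 2 powr (- real k) = (1 :: real)"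
        by (simp only: powr_add[symmetric]) simp
      moreover have "real (Suc k) powr (2 * e - \<alpha>) * real (Suc k) powr (- \<beta> - 1) = 1"
        by (simp only: powr_add[symmetric] \<beta>(1)) simp
      moreover have "q k * (G * (2 powr (- real k) * real (Suc k) powr (- \<beta> - 1))) = C * W * G * energy a k *
         ((2 powr real k * 2 powr (- real k)) * (real (Suc k) powr (2 * e - \<alpha>) * real (Suc k) powr (- \<beta> - 1)))"
        by (simp only: q_def mult_ac)
      ultimately have "q k * (G * (2 powr (- real k) * real (Suc k) powr (- \<beta> - 1))) = C * W * G * energy a k"
        by simp
      then show "ennreal (q k) * ennreal (G * (2 powr (- real k) * real (Suc k) powr (- \<beta> - 1))) = ennreal (C * W * G * energy a k)"
        using q[of k] by (simp only: ennreal_mult'[symmetric])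
    qed
    also have "\<dots> = ennreal (C * W * G * (\<Sum>k<N. energy a k))"
      unfolding sum_distrib_left using C W_pos G energy_nonneg by (intro sum_ennreal) simp
    also have "\<dots> \<le> ennreal (C * W * G * H_norm_sq w a)"
      using C W_pos G by (intro ennreal_leI mult_left_mono sum_energy_le a) simp
    finally show ?thesis .
  qed
  then show ?thesis using C W_pos G by (intro exI[of _ "C * W * G"]) auto
qed

end

subsection \<open>Convergence and the embedding\<close>

lemma summable_powr_exp:
  fixes c p :: real
  assumes "c > 0"
  shows "summable (\<lambda>k. real (Suc k) powr p * 2 powr (- c * real k))"
proof (rule summable_comparison_test_bigo)
  show "summable (\<lambda>k. norm (real k powr (- 2)))"
    by (simp add: summable_real_powr_iff)
  show "(\<lambda>k. real (Suc k) powr p * 2 powr (- c * real k)) \<in> O(\<lambda>k. real k powr (- 2))"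
    using assms by real_asymp
qed

lemma norm_dirichlet_term:
  "cmod (dirichlet_term a s n) = cmod (a (Suc n)) * real (Suc n) powr (- Re s)"
  by (simp only: dirichlet_term_def norm_mult norm_of_nat_powr[OF zero_less_Suc])

section \<open>Termwise differentiation of absolutely convergent Dirichlet series\<close>

locale abs_convergent_dirichlet =
  fixes a :: "nat \<Rightarrow> complex"
  assumes abs_summable: "\<And>\<sigma>. \<sigma> > 1 / 2 \<Longrightarrow> summable (\<lambda>n. cmod (a (Suc n)) * real (Suc n) powr (- \<sigma>))"
begin

lemma summable_dirichlet_term:
  assumes "s \<in> half_plane"
  shows "summable (dirichlet_term a s)"
proof (rule summable_norm_cancel)
  show "summable (\<lambda>n. cmod (dirichlet_term a s n))"
    unfolding norm_dirichlet_term using assms by (intro abs_summable) (simp add: half_plane_def)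
qed

lemma uniform_limit_dirichlet_series:
  assumes "\<And>s. s \<in> A \<Longrightarrow> Re s \<ge> \<sigma>" "\<sigma> > 1 / 2"
  shows "uniform_limit A (\<lambda>N s. \<Sum>n<N. dirichlet_term a s n) (dirichlet_series a) sequentially"
  unfolding dirichlet_series_def
proof (rule Weierstrass_m_test)
  show "summable (\<lambda>n. cmod (a (Suc n)) * real (Suc n) powr (- \<sigma>))"
    by (rule abs_summable) fact
  fix n s assume "s \<in> A"
  then have "real (Suc n) powr (- Re s) \<le> real (Suc n) powr (- \<sigma>)"
    using assms(1) by (intro powr_mono) auto
  then show "norm (dirichlet_term a s n) \<le> cmod (a (Suc n)) * real (Suc n) powr (- \<sigma>)"
    unfolding norm_dirichlet_term by (rule mult_left_mono) simp
qed

lemma dirichlet_term_has_field_derivative: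
  "((\<lambda>s. dirichlet_term a s n) has_field_derivative
     dirichlet_term (\<lambda>n. - of_real (ln (real n)) * a n) s n) (at s)"
proof -
  have "dirichlet_term c s n = c (Suc n) * exp (- s * of_real (ln (real (Suc n))))" for c s
    by (simp add: dirichlet_term_def powr_def Ln_of_nat del: of_nat_Suc)
  then show ?thesis
    by (auto intro!: derivative_eq_intros simp del: of_nat_Suc)
qed

text \<open>Locally uniform limits of holomorphic functions may be differentiated termwise, so
  convergence of the differentiated series comes without an estimate of its own.\<close>

lemma dirichlet_series_deriv:
  assumes s: "s \<in> half_plane"
  shows "dirichlet_series a field_differentiable at s"
    and "(\<lambda>N. \<Sum>n<N. dirichlet_term (\<lambda>n. - of_real (ln (real n)) * a n) s n)
           \<longlonglongrightarrow> deriv (dirichlet_series a) s"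
proof -
  have op: "open half_plane" unfolding half_plane_def by (rule open_halfspace_Re_gt)
  have der: "((\<lambda>s. \<Sum>n<N. dirichlet_term a s n) has_field_derivative
      (\<Sum>n<N. dirichlet_term (\<lambda>n. - of_real (ln (real n)) * a n) x n)) (at x)" for N x
    by (intro DERIV_sum dirichlet_term_has_field_derivative)
  have ul: "\<exists>d>0. cball x d \<subseteq> half_plane \<and>
      uniform_limit (cball x d) (\<lambda>N s. \<Sum>n<N. dirichlet_term a s n) (dirichlet_series a) sequentially"
    if x: "x \<in> half_plane" for x
  proof -
    \<comment> \<open>Half the distance to the boundary line, so the closed disc stays in Re s >= Re
      x - d > 1/2, where convergence is uniform.\<close>
    define d where "d = (Re x - 1 / 2) / 2"
    have d: "d > 0" "Re x - d > 1 / 2" using x by (auto simp: d_def half_plane_def field_simps)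
    have Re: "Re s \<ge> Re x - d" if "s \<in> cball x d" for s
      using that abs_Re_le_cmod[of "x - s"] by (simp add: dist_norm)
    then have "cball x d \<subseteq> half_plane" using d by (force simp: half_plane_def)
    moreover have "uniform_limit (cball x d) (\<lambda>N s. \<Sum>n<N. dirichlet_term a s n) (dirichlet_series a) sequentially"
      by (rule uniform_limit_dirichlet_series[OF Re d(2)])
    ultimately show ?thesis using d by blast
  qed
  obtain g' where g': "\<And>x. x \<in> half_plane \<Longrightarrow> (dirichlet_series a has_field_derivative g' x) (at x)"
     "\<And>x. x \<in> half_plane \<Longrightarrow> (\<lambda>N. \<Sum>n<N. dirichlet_term (\<lambda>n. - of_real (ln (real n)) * a n) x n) \<longlonglongrightarrow> g' x"
    using has_complex_derivative_uniform_sequence[OF op der ul] by blast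
  show "dirichlet_series a field_differentiable at s"
    using g'(1)[OF s] field_differentiable_def by blast
  show "(\<lambda>N. \<Sum>n<N. dirichlet_term (\<lambda>n. - of_real (ln (real n)) * a n) s n)
           \<longlonglongrightarrow> deriv (dirichlet_series a) s"
    using g'(2)[OF s] DERIV_imp_deriv[OF g'(1)[OF s]] by simp
qed

lemma dirichlet_series_holomorphic: "dirichlet_series a holomorphic_on half_plane"
  unfolding holomorphic_on_def
  using field_differentiable_at_within[OF dirichlet_series_deriv(1)] by blast

end

text \<open>These are the ordinary partial sums along the subsequence 2^N - 1; the -1 is the index
  shift in \<open>dirichlet_term\<close>.\<close>

lemma dyadic_partial_sum_tendsto:
  assumes "(\<lambda>N. \<Sum>n<N. dirichlet_term c s n) \<longlonglongrightarrow> L"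
  shows "(\<lambda>N. dyadic_partial_sum N c s) \<longlonglongrightarrow> L"
proof -
  have "strict_mono (\<lambda>N. 2 ^ N - 1 :: nat)"
  proof (rule strict_monoI_Suc)
    fix N
    have "(1 :: nat) \<le> 2 ^ N" by simp
    then show "(2 :: nat) ^ N - 1 < 2 ^ Suc N - 1" unfolding power_Suc by linarith
  qed
  from LIMSEQ_subseq_LIMSEQ[OF assms this] show ?thesis
    by (simp only: o_def dyadic_partial_sum_def dirichlet_term_def
        sum_Suc_pow2[of "\<lambda>n. c n * of_nat n powr (- s)"])
qed

text \<open>Reduces arbitrary bounded intervals to the symmetric ones for which the mean values were
  estimated.\<close>

lemma local_energy_mono:
  assumes "I \<subseteq> J"
  shows "local_energy \<alpha> I F \<le> local_energy \<alpha> J F"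
proof -
  have "strip I \<subseteq> strip J" using assms by (auto simp: strip_def)
  then have 1: "indicator (strip I) s \<le> (indicator (strip J) s :: ennreal)" for s
    by (auto simp: indicator_def)
  have 2: "indicator I t \<le> (indicator J t :: ennreal)" for t
    using assms by (auto simp: indicator_def)
  have "(\<integral>\<^sup>+s\<in>strip I. g s \<partial>lborel) \<le> (\<integral>\<^sup>+s\<in>strip J. g s \<partial>lborel)" for g
    by (intro nn_integral_mono mult_left_mono 1) simp
  moreover have "(\<integral>\<^sup>+t\<in>I. g t \<partial>lborel) \<le> (\<integral>\<^sup>+t\<in>J. g t \<partial>lborel)" for g
    by (intro nn_integral_mono mult_left_mono 2) simp
  ultimately show ?thesis
    by (simp add: local_energy_def SUP_mono')
qed

section \<open>From the coefficient bound to the embedding\<close>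

context dyadic_weight
begin

text \<open>On each block the squared sum is at most the product of \<open>energy a k\<close> and
  \<open>d k\<close>, hence the sum is at most \<open>energy a k + d k\<close>. The energies add up
  to at most the norm, and \<open>d k\<close> decays geometrically up to a power because \<sigma> >
  1/2.\<close>

lemma abs_convergent:
  assumes a: "a \<in> H_space w"
  shows "abs_convergent_dirichlet a"
proof
  fix \<sigma> :: real assume \<sigma>: "\<sigma> > 1 / 2"
  define d where "d = (\<lambda>k. W * (real (Suc k) powr (- \<alpha>) * 2 powr (- (2 * \<sigma> - 1) * real k)))"
  have d: "summable d" "d k \<ge> 0" for k
    unfolding d_def using W_pos \<sigma> summable_mult[OF summable_powr_exp[of "2 * \<sigma> - 1" "- \<alpha>"], of W] by auto
  have b: "(\<Sum>n\<in>dyadic k. cmod (a n) * real n powr (- \<sigma>)) \<le> energy a k + d k" for k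
  proof (rule power2_le_imp_le)
    have "(\<Sum>n\<in>dyadic k. cmod (a n) * real n powr (- \<sigma>))\<^sup>2
      \<le> energy a k * (W * (2 powr real k * real (Suc k) powr (2 * 0 - \<alpha>) * 2 powr (- 2 * real k * \<sigma>)))"
      using \<sigma> by (intro dyadic_block_le a) auto
    also have "\<dots> = energy a k * d k"
    proof -
      have "2 powr real k * 2 powr (- 2 * real k * \<sigma>) = 2 powr (- (2 * \<sigma> - 1) * real k)"
        by (simp only: powr_add[symmetric]) (simp add: algebra_simps)
      then show ?thesis by (simp add: d_def mult_ac)
    qed
    also have "\<dots> \<le> (energy a k + d k)\<^sup>2"
      using energy_nonneg[of a k] d(2)[of k] by (simp add: power2_eq_square algebra_simps)
    finally show "(\<Sum>n\<in>dyadic k. cmod (a n) * real n powr (- \<sigma>))\<^sup>2 \<le> (energy a k + d k)\<^sup>2" .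
  qed (use energy_nonneg d in simp)
  show "summable (\<lambda>n. cmod (a (Suc n)) * real (Suc n) powr (- \<sigma>))"
  proof (rule summableI_nonneg_bounded)
    fix M
    have "M \<le> 2 ^ M - 1" using less_exp[of M] by linarith
    then have "(\<Sum>n<M. cmod (a (Suc n)) * real (Suc n) powr (- \<sigma>))
      \<le> (\<Sum>n<2 ^ M - 1. cmod (a (Suc n)) * real (Suc n) powr (- \<sigma>))"
      by (intro sum_mono2) auto
    also have "\<dots> = (\<Sum>k<M. \<Sum>n\<in>dyadic k. cmod (a n) * real n powr (- \<sigma>))"
      by (simp only: sum_Suc_pow2[of "\<lambda>n. cmod (a n) * real n powr (- \<sigma>)"] sum_dyadic)
    also have "\<dots> \<le> (\<Sum>k<M. energy a k) + (\<Sum>k<M. d k)"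
      unfolding sum.distrib[symmetric] by (intro sum_mono b)
    also have "\<dots> \<le> H_norm_sq w a + suminf d"
      using d by (intro add_mono sum_energy_le a sum_le_suminf) auto
    finally show "(\<Sum>n<M. cmod (a (Suc n)) * real (Suc n) powr (- \<sigma>)) \<le> H_norm_sq w a + suminf d" .
  qed simp
qed

text \<open>In each case the partial sums are bounded uniformly in N, and Fatou's lemma passes to
  the limit.\<close>

lemma local_energy_le:
  assumes \<alpha>: "\<alpha> \<le> 1" and R: "R \<ge> 0"
  shows "\<exists>C>0. \<forall>a\<in>H_space w. local_energy \<alpha> {-R..R} (dirichlet_series a) \<le> ennreal (C * H_norm_sq w a)"
proof -
  consider (neg) "\<alpha> < 0" | (zero) "\<alpha> = 0" | (pos) "\<alpha> > 0" by linarith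
  then show ?thesis
  proof cases
    case neg
    \<comment> \<open>The weight exponent is the one belonging to e = 0; it exceeds -1 because
      \<alpha> < 0.\<close>
    obtain C where C: "C > 0" and le: "\<And>N a c. a \<in> H_space w \<Longrightarrow>
        (\<forall>k. \<forall>n\<in>dyadic k. cmod (c n) \<le> cmod (a n) * real (Suc k) powr 0) \<Longrightarrow>
        (\<integral>\<^sup>+s\<in>strip {-R..R}. ennreal ((cmod (dyadic_partial_sum N c s))\<^sup>2 * (Re s - 1 / 2) powr (- \<alpha> - 1)) \<partial>lborel)
        \<le> ennreal (C * H_norm_sq w a)"
      using strip_bound[OF R, of "- \<alpha> - 1" 0] neg by auto
    have "local_energy \<alpha> {-R..R} (dirichlet_series a) \<le> ennreal (C * H_norm_sq w a)" if a: "a \<in> H_space w" for a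
    proof -
      interpret abs_convergent_dirichlet a by (rule abs_convergent[OF a])
      have "(\<integral>\<^sup>+s\<in>strip {-R..R}. ennreal ((cmod (dirichlet_series a s))\<^sup>2 * (Re s - 1 / 2) powr (- \<alpha> - 1)) \<partial>lborel)
        \<le> ennreal (C * H_norm_sq w a)"
      proof (rule nn_integral_le_of_tendsto[OF _ _ le[OF a, of a]])
        fix s
        show "(\<lambda>N. ennreal ((cmod (dyadic_partial_sum N a s))\<^sup>2 * (Re s - 1 / 2) powr (- \<alpha> - 1)) * indicator (strip {-R..R}) s)
          \<longlonglongrightarrow> ennreal ((cmod (dirichlet_series a s))\<^sup>2 * (Re s - 1 / 2) powr (- \<alpha> - 1)) * indicator (strip {-R..R}) s"
        proof (cases "s \<in> strip {-R..R}")
          case True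
          then have "s \<in> half_plane" by (simp add: strip_def half_plane_def)
          from summable_LIMSEQ[OF summable_dirichlet_term[OF this]]
          have "(\<lambda>N. dyadic_partial_sum N a s) \<longlonglongrightarrow> dirichlet_series a s"
            unfolding dirichlet_series_def by (rule dyadic_partial_sum_tendsto)
          with True show ?thesis by (auto intro!: tendsto_intros)
        qed simp
      qed simp_all
      then show ?thesis using neg by (simp add: local_energy_def)
    qed
    with C show ?thesis by blast
  next
    case zero
    obtain C where C: "C > 0" and le: "\<And>N a \<sigma>. a \<in> H_space w \<Longrightarrow> \<sigma> > 1 / 2 \<Longrightarrow>
       (\<integral>\<^sup>+t\<in>{-R..R}. ennreal ((cmod (dyadic_partial_sum N a (Complex \<sigma> t)))\<^sup>2) \<partial>lborel)
      \<le> ennreal (C * H_norm_sq w a)"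
      using line_bound[OF R zero] by auto
    have "local_energy \<alpha> {-R..R} (dirichlet_series a) \<le> ennreal (C * H_norm_sq w a)" if a: "a \<in> H_space w" for a
    proof -
      interpret abs_convergent_dirichlet a by (rule abs_convergent[OF a])
      have "(\<integral>\<^sup>+t\<in>{-R..R}. ennreal ((cmod (dirichlet_series a (Complex \<sigma> t)))\<^sup>2) \<partial>lborel)
        \<le> ennreal (C * H_norm_sq w a)" if \<sigma>: "\<sigma> > 1 / 2" for \<sigma>
      proof (rule nn_integral_le_of_tendsto[OF _ _ le[OF a \<sigma>]])
        fix t
        have "Complex \<sigma> t \<in> half_plane" using \<sigma> by (simp add: half_plane_def)
        from summable_LIMSEQ[OF summable_dirichlet_term[OF this]]
        have "(\<lambda>N. dyadic_partial_sum N a (Complex \<sigma> t)) \<longlonglongrightarrow> dirichlet_series a (Complex \<sigma> t)"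
          unfolding dirichlet_series_def by (rule dyadic_partial_sum_tendsto)
        then show "(\<lambda>N. ennreal ((cmod (dyadic_partial_sum N a (Complex \<sigma> t)))\<^sup>2) * indicator {-R..R} t)
          \<longlonglongrightarrow> ennreal ((cmod (dirichlet_series a (Complex \<sigma> t)))\<^sup>2) * indicator {-R..R} t"
          by (cases "t \<in> {-R..R}") (auto intro!: tendsto_intros)
      qed simp
      then show ?thesis using zero by (auto simp: local_energy_def intro!: SUP_least)
    qed
    with C show ?thesis by blast
  next
    case pos
    \<comment> \<open>Taking e = 1 pays for the factor ln n of the derivative; the weight exponent 1
      - \<alpha> is nonnegative since \<alpha> <= 1.\<close>
    obtain C where C: "C > 0" and le: "\<And>N a c. a \<in> H_space w \<Longrightarrow>
        (\<forall>k. \<forall>n\<in>dyadic k. cmod (c n) \<le> cmod (a n) * real (Suc k) powr 1) \<Longrightarrow>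
        (\<integral>\<^sup>+s\<in>strip {-R..R}. ennreal ((cmod (dyadic_partial_sum N c s))\<^sup>2 * (Re s - 1 / 2) powr (- \<alpha> + 1)) \<partial>lborel)
        \<le> ennreal (C * H_norm_sq w a)"
      using strip_bound[OF R, of "- \<alpha> + 1" 1] \<alpha> by auto
    have "local_energy \<alpha> {-R..R} (dirichlet_series a) \<le> ennreal (C * H_norm_sq w a)" if a: "a \<in> H_space w" for a
    proof -
      interpret abs_convergent_dirichlet a by (rule abs_convergent[OF a])
      let ?c = "\<lambda>n. - of_real (ln (real n)) * a n"
      have c: "\<forall>k. \<forall>n\<in>dyadic k. cmod (?c n) \<le> cmod (a n) * real (Suc k) powr 1"
      proof (intro allI ballI)
        fix k n assume n: "n \<in> dyadic k"
        have "ln (real n) \<le> real (Suc k) * ln 2" by (rule ln_dyadic(2)[OF n])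
        also have "\<dots> \<le> real (Suc k) * 1"
          using ln_le_minus_one[of "2 :: real"] by (intro mult_left_mono) auto
        finally have "\<bar>ln (real n)\<bar> \<le> real (Suc k)"
          using dyadic_pos[OF n] by simp
        then show "cmod (?c n) \<le> cmod (a n) * real (Suc k) powr 1"
          by (simp add: norm_mult mult.commute mult_left_mono)
      qed
      have "(\<integral>\<^sup>+s\<in>strip {-R..R}. ennreal ((cmod (deriv (dirichlet_series a) s))\<^sup>2 * (Re s - 1 / 2) powr (- \<alpha> + 1)) \<partial>lborel)
        \<le> ennreal (C * H_norm_sq w a)"
      proof (rule nn_integral_le_of_tendsto[OF _ _ le[OF a c]])
        fix s
        show "(\<lambda>N. ennreal ((cmod (dyadic_partial_sum N ?c s))\<^sup>2 * (Re s - 1 / 2) powr (- \<alpha> + 1)) * indicator (strip {-R..R}) s)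
          \<longlonglongrightarrow> ennreal ((cmod (deriv (dirichlet_series a) s))\<^sup>2 * (Re s - 1 / 2) powr (- \<alpha> + 1)) * indicator (strip {-R..R}) s"
        proof (cases "s \<in> strip {-R..R}")
          case True
          then have "s \<in> half_plane" by (simp add: strip_def half_plane_def)
          then have "(\<lambda>N. dyadic_partial_sum N ?c s) \<longlonglongrightarrow> deriv (dirichlet_series a) s"
            by (intro dyadic_partial_sum_tendsto dirichlet_series_deriv(2))
          with True show ?thesis by (auto intro!: tendsto_intros)
        qed simp
      qed simp
      then show ?thesis using pos by (simp add: local_energy_def)
    qed
    with C show ?thesis by blast
  qed
qed

lemma locally_embedded:
  assumes \<alpha>: "\<alpha> \<le> 1"
  shows "locally_embedded w \<alpha>"
  unfolding locally_embedded_def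
proof (intro conjI ballI allI impI)
  fix a assume a: "a \<in> H_space w"
  interpret abs_convergent_dirichlet a by (rule abs_convergent[OF a])
  show "dirichlet_series a holomorphic_on half_plane" by (rule dirichlet_series_holomorphic)
  show "summable (dirichlet_term a s)" if "s \<in> half_plane" for s
    using that by (rule summable_dirichlet_term)
next
  fix I :: "real set" assume "is_interval I \<and> bounded I"
  then obtain R where R: "\<And>x. x \<in> I \<Longrightarrow> \<bar>x\<bar> \<le> R" by (auto simp: bounded_real)
  then have I: "I \<subseteq> {-\<bar>R\<bar>..\<bar>R\<bar>}" by (force simp: abs_le_iff)
  obtain C where C: "C > 0" "\<forall>a\<in>H_space w. local_energy \<alpha> {-\<bar>R\<bar>..\<bar>R\<bar>} (dirichlet_series a) \<le> ennreal (C * H_norm_sq w a)"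
    using local_energy_le[OF \<alpha>, of "\<bar>R\<bar>"] by auto
  show "\<exists>C>0. \<forall>a\<in>H_space w. local_energy \<alpha> I (dirichlet_series a) \<le> ennreal (C * H_norm_sq w a)"
    by (intro exI[of _ C] conjI ballI order_trans[OF local_energy_mono[OF I]]) (use C in auto)
qed

end

subsection \<open>Necessity of the coefficient bound\<close>

lemma finite_nat_le_real: "finite {n. real n \<le> x}"
proof (rule finite_subset)
  show "{n. real n \<le> x} \<subseteq> {..nat \<lceil>x\<rceil>}" by (auto simp: nat_le_iff ceiling_le_iff) linarith
qed simp

text \<open>Block k lies in the range of summation for x = 2^(k + 1), which is at least 2 even for k
  = 0. There ln x = (k + 1) ln 2, and the constants 2 and (ln 2)^(-\<alpha>) come out.\<close>

lemma dyadic_weight_of_sum_bound: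
  fixes w :: "nat \<Rightarrow> real"
  assumes w: "\<And>n. n \<ge> 1 \<Longrightarrow> w n \<ge> 0" and C: "C > 0"
    and le: "\<And>x. x \<ge> 2 \<Longrightarrow> (\<Sum>n | 1 \<le> n \<and> real n \<le> x. w n) \<le> C * (x / (ln x) powr \<alpha>)"
  shows "dyadic_weight w \<alpha> (2 * C * ln 2 powr (- \<alpha>))"
proof
  show "2 * C * ln 2 powr (- \<alpha>) > 0" using C by simp
  fix k
  have fin: "finite {n. 1 \<le> n \<and> real n \<le> 2 ^ Suc k}"
    by (rule finite_subset[OF _ finite_nat_le_real[of "2 ^ Suc k"]]) blast
  have sub: "dyadic k \<subseteq> {n. 1 \<le> n \<and> real n \<le> 2 ^ Suc k}"
  proof
    fix n assume n: "n \<in> dyadic k"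
    then have "n \<le> 2 ^ Suc k" by simp
    then have "real n \<le> 2 ^ Suc k" using of_nat_le_iff[of n "2 ^ Suc k", where 'a = real] by simp
    with n show "n \<in> {n. 1 \<le> n \<and> real n \<le> 2 ^ Suc k}"
      using order_trans[of 1 "2 ^ k" n] by simp
  qed
  have "(\<Sum>n\<in>dyadic k. w n) \<le> (\<Sum>n | 1 \<le> n \<and> real n \<le> 2 ^ Suc k. w n)"
    by (rule sum_mono2[OF fin sub]) (use w in auto)
  also have "\<dots> \<le> C * (2 ^ Suc k / (ln (2 ^ Suc k)) powr \<alpha>)"
    by (rule le) simp
  also have "ln (2 ^ Suc k) = real (Suc k) * ln (2 :: real)"
    by (simp only: ln_realpow zero_less_numeral)
  also have "C * (2 ^ Suc k / (real (Suc k) * ln 2) powr \<alpha>)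
      = 2 * C * ln 2 powr (- \<alpha>) * (2 ^ k * real (Suc k) powr (- \<alpha>))"
    by (simp add: powr_mult powr_minus divide_simps)
  finally show "(\<Sum>n\<in>dyadic k. w n) \<le> 2 * C * ln 2 powr (- \<alpha>) * (2 ^ k * real (Suc k) powr (- \<alpha>))" .
qed (rule w)

section \<open>Lower bounds on half blocks\<close>

text \<open>Half open, so that the blocks of x, x/2, x/4, ... are disjoint; x stays real because the
  coefficient bound is asked for every real x.\<close>

definition half_block :: "real \<Rightarrow> nat set" where
  "half_block x = {n. x / 2 < real n \<and> real n \<le> x}"

lemma finite_half_block [simp]: "finite (half_block x)"
  by (rule finite_subset[OF _ finite_nat_le_real[of x]]) (auto simp: half_block_def)

lemma half_block_ge_2: "x \<ge> 2 \<Longrightarrow> n \<in> half_block x \<Longrightarrow> n \<ge> 2"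
  by (auto simp: half_block_def)

text \<open>The last bound rests on x <= 2 n <= n^2 for n >= 2; it recovers the logarithms produced
  by differentiation.\<close>

lemma ln_half_block:
  assumes x: "x \<ge> 2" and n: "n \<in> half_block x"
  shows "ln (real n) \<le> ln x" "ln x - ln 2 \<le> ln (real n)" "ln x / 2 \<le> ln (real n)"
proof -
  have n2: "real n \<ge> 2" using half_block_ge_2[OF x n] by simp
  have b: "x / 2 \<le> real n" "real n \<le> x" using n by (auto simp: half_block_def)
  then show "ln (real n) \<le> ln x" using n2 x by simp
  have "ln (x / 2) \<le> ln (real n)" using b n2 x by simp
  then show "ln x - ln 2 \<le> ln (real n)" using x by (simp add: ln_div)
  have "x \<le> real n * 2" using b by simp
  also have "\<dots> \<le> real n * real n" using n2 by (intro mult_left_mono) auto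
  finally have "ln x \<le> ln (real n * real n)" using x n2 by simp
  then show "ln x / 2 \<le> ln (real n)" using n2 by (simp add: ln_mult)
qed

text \<open>On the block all phases \<^term>\<open>t * ln (real n)\<close> with \<open>0 \<le> t \<le> 1\<close> lie within \<open>ln 2 < pi / 3\<close>
  of each other, so there is no cancellation.\<close>

lemma norm_block_sum_ge:
  fixes b :: "nat \<Rightarrow> real"
  assumes x: "x \<ge> 2" and b: "\<And>n. n \<in> half_block x \<Longrightarrow> b n \<ge> 0"
    and s: "0 \<le> Re s" "0 \<le> Im s" "Im s \<le> 1"
  shows "x powr (- Re s) / 2 * (\<Sum>n\<in>half_block x. b n)
      \<le> cmod (\<Sum>n\<in>half_block x. of_real (b n) * of_nat n powr (- s))"
proof -
  define \<sigma> t where "\<sigma> = Re s" and "t = Im s"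
  have s_eq: "s = Complex \<sigma> t" by (simp add: \<sigma>_def t_def)
  have "x powr (- \<sigma>) / 2 * (\<Sum>n\<in>half_block x. b n)
      \<le> (\<Sum>n\<in>half_block x. b n * real n powr (- \<sigma>) * cos ((ln x - ln (real n)) * t))"
    unfolding sum_distrib_left
  proof (rule sum_mono)
    fix n assume n: "n \<in> half_block x"
    note l = ln_half_block[OF x n]
    have "(ln x - ln (real n)) * t \<le> 1 * 1"
      using l s ln_le_minus_one[of "2 :: real"] by (intro mult_mono) (auto simp: t_def)
    moreover have "0 \<le> (ln x - ln (real n)) * t" using l s by (simp add: t_def)
    ultimately have "cos (pi / 3) \<le> cos ((ln x - ln (real n)) * t)"
      using pi_gt3 by (intro cos_monotone_0_pi_le) auto
    then have c: "1 / 2 \<le> cos ((ln x - ln (real n)) * t)" by (simp add: cos_60)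
    have "real n > 0" "real n \<le> x" using half_block_ge_2[OF x n] n by (auto simp: half_block_def)
    then have "x powr (- \<sigma>) \<le> real n powr (- \<sigma>)"
      using s by (intro powr_mono2') (auto simp: \<sigma>_def)
    then have "(b n * x powr (- \<sigma>)) * (1 / 2) \<le> (b n * real n powr (- \<sigma>)) * cos ((ln x - ln (real n)) * t)"
      using c b[OF n] by (intro mult_mono mult_left_mono) auto
    then show "x powr (- \<sigma>) / 2 * b n \<le> b n * real n powr (- \<sigma>) * cos ((ln x - ln (real n)) * t)"
      by (simp add: mult_ac)
  qed
  \<comment> \<open>Rotating by the phase of x itself preserves the modulus and leaves the terms
    with the small angles (ln x - ln n) t; the real part then bounds the modulus from below.\<close>
  also have "\<dots> = Re (cis (ln x * t) * (\<Sum>n\<in>half_block x. of_real (b n) * of_nat n powr (- s)))"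
    unfolding sum_distrib_left Re_sum
  proof (rule sum.cong[OF refl])
    fix n assume n: "n \<in> half_block x"
    have "cis (ln x * t) * (of_real (b n) * of_nat n powr (- s))
       = of_real (b n * real n powr (- \<sigma>)) * (cis (ln x * t) * cis (- ln (real n) * t))"
      unfolding s_eq using half_block_ge_2[OF x n] by (subst of_nat_powr_Complex) (simp_all add: mult_ac)
    also have "cis (ln x * t) * cis (- ln (real n) * t) = cis ((ln x - ln (real n)) * t)"
      by (simp add: cis_mult algebra_simps)
    finally have "cis (ln x * t) * (of_real (b n) * of_nat n powr (- s))
       = of_real (b n * real n powr (- \<sigma>)) * cis ((ln x - ln (real n)) * t)" .
    then show "b n * real n powr (- \<sigma>) * cos ((ln x - ln (real n)) * t)
        = Re (cis (ln x * t) * (of_real (b n) * of_nat n powr (- s)))" by (simp only:) simp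
  qed
  also have "\<dots> \<le> cmod (cis (ln x * t) * (\<Sum>n\<in>half_block x. of_real (b n) * of_nat n powr (- s)))"
    by (rule complex_Re_le_cmod)
  finally show ?thesis by (simp add: norm_mult \<sigma>_def)
qed

lemma norm_sq_block_sum_ge:
  fixes b :: "nat \<Rightarrow> real"
  assumes x: "x \<ge> 2" and b: "\<And>n. n \<in> half_block x \<Longrightarrow> b n \<ge> 0"
    and s: "1 / 2 \<le> Re s" "Re s \<le> 1 / 2 + 1 / (4 * ln x)" "0 \<le> Im s" "Im s \<le> 1"
  shows "(\<Sum>n\<in>half_block x. b n)\<^sup>2 / (8 * x)
      \<le> (cmod (\<Sum>n\<in>half_block x. of_real (b n) * of_nat n powr (- s)))\<^sup>2"
proof -
  have L: "ln x > 0" using x by simp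
  have "x powr (- 2 * Re s) \<ge> x powr (- 1 - 1 / (2 * ln x))"
    using x s by (intro powr_mono) auto
  also have "x powr (- 1 - 1 / (2 * ln x)) = exp (- (1 / 2)) / x"
  proof -
    have "(- 1 - 1 / (2 * ln x)) * ln x = - (1 / 2) - ln x" using L by (simp add: field_simps)
    then have "x powr (- 1 - 1 / (2 * ln x)) = exp (- (1 / 2) - ln x)"
      using x by (simp add: powr_def)
    then show ?thesis using x by (simp only: exp_diff exp_ln)
  qed
  also have "\<dots> \<ge> (1 / 2) / x"
    using x exp_ge_add_one_self[of "- (1 / 2)"] by (intro divide_right_mono) auto
  finally have *: "1 / (2 * x) \<le> x powr (- 2 * Re s)" by simp
  have "(\<Sum>n\<in>half_block x. b n)\<^sup>2 / (8 * x) = 1 / (2 * x) * ((\<Sum>n\<in>half_block x. b n)\<^sup>2 / 4)"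
    by simp
  also have "\<dots> \<le> x powr (- 2 * Re s) * ((\<Sum>n\<in>half_block x. b n)\<^sup>2 / 4)"
    by (intro mult_right_mono *) simp
  also have "\<dots> = (x powr (- Re s) / 2 * (\<Sum>n\<in>half_block x. b n))\<^sup>2"
    by (simp add: power_mult_distrib power_divide) (simp add: power2_eq_square flip: powr_add)
  also have "\<dots> \<le> (cmod (\<Sum>n\<in>half_block x. of_real (b n) * of_nat n powr (- s)))\<^sup>2"
    using s x b by (intro power_mono norm_block_sum_ge mult_nonneg_nonneg sum_nonneg) auto
  finally show ?thesis .
qed

text \<open>Only a rectangle of height 1 and width comparable with 1 / ln x is kept. There the block
  sum is bounded below and the weight is comparable with (ln x)^(-\<beta>); the width supplies the
  remaining factor 1 / ln x.\<close>

lemma strip_energy_ge: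
  fixes \<beta> :: real
  shows "\<exists>\<kappa>>0. \<forall>x\<ge>2. \<forall>b :: nat \<Rightarrow> real. (\<forall>n\<in>half_block x. b n \<ge> 0) \<longrightarrow>
    ennreal (\<kappa> * (\<Sum>n\<in>half_block x. b n)\<^sup>2 / x * ln x powr (- \<beta> - 1)) \<le>
    (\<integral>\<^sup>+s\<in>strip {0..1}. ennreal ((cmod (\<Sum>n\<in>half_block x. of_real (b n) * of_nat n powr (- s)))\<^sup>2
        * (Re s - 1 / 2) powr \<beta>) \<partial>lborel)"
proof -
  \<comment> \<open>The least ratio of (\<sigma> - 1/2)^\<beta> to h^\<beta> for \<sigma> - 1/2 in
    [h/2, h]: attained at the left edge if \<beta> >= 0, at the right edge otherwise.\<close>
  define \<mu> where "\<mu> = min 1 (2 powr (- \<beta>))"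
  have \<mu>: "\<mu> > 0" by (simp add: \<mu>_def)
  \<comment> \<open>1/16 is the 1/8 of the block bound times the 1/2 in the area h / 2; the power of
    4 comes from h = 1 / (4 ln x).\<close>
  define \<kappa> where "\<kappa> = \<mu> * 4 powr (- \<beta> - 1) / 16"
  have "ennreal (\<kappa> * (\<Sum>n\<in>half_block x. b n)\<^sup>2 / x * ln x powr (- \<beta> - 1)) \<le>
    (\<integral>\<^sup>+s\<in>strip {0..1}. ennreal ((cmod (\<Sum>n\<in>half_block x. of_real (b n) * of_nat n powr (- s)))\<^sup>2
        * (Re s - 1 / 2) powr \<beta>) \<partial>lborel)"
    if x: "x \<ge> 2" and b: "\<And>n. n \<in> half_block x \<Longrightarrow> b n \<ge> 0" for x and b :: "nat \<Rightarrow> real"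
  proof -
    define V where "V = (\<Sum>n\<in>half_block x. b n)"
    define h where "h = 1 / (4 * ln x)"
    have "ln 2 \<le> ln x" using x by simp
    then have L: "ln x \<ge> 2 / 3" using ln2_ge_two_thirds by linarith
    then have h: "h > 0" "h \<le> 1 / 2" by (auto simp: h_def field_simps)
    define Q where "Q = cbox (Complex (1 / 2 + h / 2) 0) (Complex (1 / 2 + h) 1)"
    define m where "m = V\<^sup>2 / (8 * x) * (\<mu> * h powr \<beta>)"
    have m: "m \<ge> 0" using x \<mu> by (simp add: m_def)
    have "emeasure lborel Q = ennreal (h / 2)"
      unfolding Q_def using h by (subst emeasure_lborel_cbox) (auto simp: Basis_complex_def field_simps)
    then have "ennreal (m * (h / 2)) = ennreal m * emeasure lborel Q"
      using m by (simp only: ennreal_mult')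
    also have "\<dots> = (\<integral>\<^sup>+s. ennreal m * indicator Q s \<partial>lborel)"
      by (rule nn_integral_cmult_indicator[symmetric]) (simp add: Q_def)
    also have "\<dots> \<le> (\<integral>\<^sup>+s\<in>strip {0..1}. ennreal ((cmod (\<Sum>n\<in>half_block x. of_real (b n) * of_nat n powr (- s)))\<^sup>2
        * (Re s - 1 / 2) powr \<beta>) \<partial>lborel)"
    proof (rule nn_integral_mono)
      fix s
      show "ennreal m * indicator Q s \<le> ennreal ((cmod (\<Sum>n\<in>half_block x. of_real (b n) * of_nat n powr (- s)))\<^sup>2
        * (Re s - 1 / 2) powr \<beta>) * indicator (strip {0..1}) s"
      proof (cases "s \<in> Q")
        case True
        then have s: "h / 2 \<le> Re s - 1 / 2" "Re s - 1 / 2 \<le> h" "0 \<le> Im s" "Im s \<le> 1"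
          by (auto simp: Q_def in_cbox_complex_iff)
        have "\<mu> * h powr \<beta> \<le> (Re s - 1 / 2) powr \<beta>"
        proof (cases "\<beta> \<ge> 0")
          case True
          have "\<mu> * h powr \<beta> \<le> 2 powr (- \<beta>) * h powr \<beta>"
            by (intro mult_right_mono) (auto simp: \<mu>_def)
          also have "\<dots> = (h / 2) powr \<beta>" using h by (simp add: powr_divide powr_minus_divide)
          also have "\<dots> \<le> (Re s - 1 / 2) powr \<beta>" using s h True by (intro powr_mono2) auto
          finally show ?thesis .
        next
          case False
          have "\<mu> * h powr \<beta> \<le> 1 * h powr \<beta>"
            by (intro mult_right_mono) (auto simp: \<mu>_def)
          also have "\<dots> \<le> (Re s - 1 / 2) powr \<beta>" using s h False by (simp add: powr_mono2')
          finally show ?thesis .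
        qed
        moreover have "V\<^sup>2 / (8 * x) \<le> (cmod (\<Sum>n\<in>half_block x. of_real (b n) * of_nat n powr (- s)))\<^sup>2"
          unfolding V_def using s h by (intro norm_sq_block_sum_ge x b) (auto simp: h_def)
        ultimately have "m \<le> (cmod (\<Sum>n\<in>half_block x. of_real (b n) * of_nat n powr (- s)))\<^sup>2 * (Re s - 1 / 2) powr \<beta>"
          unfolding m_def using \<mu> by (intro mult_mono) auto
        moreover have "s \<in> strip {0..1}" using s h by (simp add: strip_def)
        ultimately show ?thesis using True by (simp add: ennreal_leI)
      qed simp
    qed
    also have "m * (h / 2) = \<kappa> * V\<^sup>2 / x * ln x powr (- \<beta> - 1)"
    proof -
      have "h powr \<beta> * h = h powr (\<beta> + 1)" using h by (simp add: powr_add)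
      also have "\<dots> = 4 powr (- \<beta> - 1) * ln x powr (- \<beta> - 1)"
      proof -
        have "h = (4 * ln x) powr (- 1)" using L by (simp add: h_def powr_minus_divide)
        moreover have "- 1 * (\<beta> + 1) = - \<beta> - 1" by simp
        ultimately have "h powr (\<beta> + 1) = (4 * ln x) powr (- \<beta> - 1)"
          by (simp only: powr_powr)
        then show ?thesis using L by (simp add: powr_mult)
      qed
      finally have "h powr \<beta> * h = 4 powr (- \<beta> - 1) * ln x powr (- \<beta> - 1)" .
      moreover have "m * (h / 2) = V\<^sup>2 / (8 * x) * \<mu> * (h powr \<beta> * h) / 2" by (simp add: m_def)
      ultimately show ?thesis by (simp add: \<kappa>_def)
    qed
    finally show ?thesis by (simp add: V_def)
  qed
  then show ?thesis using \<mu> by (intro exI[of _ \<kappa>]) (auto simp: \<kappa>_def)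
qed

section \<open>Test coefficients\<close>

lemma sums_Suc_finite_support:
  fixes f :: "nat \<Rightarrow> 'a :: real_normed_vector"
  assumes "finite B" "0 \<notin> B" "\<And>n. n \<notin> B \<Longrightarrow> f n = 0"
  shows "(\<lambda>n. f (Suc n)) sums (\<Sum>n\<in>B. f n)"
  using sums_finite[OF assms(1,3)] assms(2,3) by (simp add: sums_Suc_iff)

text \<open>The choice a_n = w_n is the equality case of Cauchy-Schwarz: |a_n|^2 / w_n = w_n, so the
  squared norm and the sum of the coefficients coincide.\<close>

definition block_coeff :: "(nat \<Rightarrow> real) \<Rightarrow> real \<Rightarrow> nat \<Rightarrow> complex" where
  "block_coeff w x n = (if n \<in> half_block x then of_real (w n) else 0)"

lemma zero_notin_half_block: "x \<ge> 2 \<Longrightarrow> 0 \<notin> half_block x"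
  by (auto simp: half_block_def)

lemma block_coeff_H:
  assumes x: "x \<ge> 2"
  shows "block_coeff w x \<in> H_space w" "H_norm_sq w (block_coeff w x) = (\<Sum>n\<in>half_block x. w n)"
proof -
  have "(\<lambda>n. (cmod (block_coeff w x (Suc n)))\<^sup>2 / w (Suc n)) sums (\<Sum>n\<in>half_block x. (cmod (block_coeff w x n))\<^sup>2 / w n)"
    by (rule sums_Suc_finite_support[where f = "\<lambda>n. (cmod (block_coeff w x n))\<^sup>2 / w n"])
       (use zero_notin_half_block[OF x] in \<open>auto simp: block_coeff_def\<close>)
  \<comment> \<open>This includes indices with \<open>w n = 0\<close>, where 0 / 0 = 0.\<close>
  also have "(\<Sum>n\<in>half_block x. (cmod (block_coeff w x n))\<^sup>2 / w n) = (\<Sum>n\<in>half_block x. w n)"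
    by (intro sum.cong) (auto simp: block_coeff_def power2_eq_square)
  finally have s: "(\<lambda>n. (cmod (block_coeff w x (Suc n)))\<^sup>2 / w (Suc n)) sums (\<Sum>n\<in>half_block x. w n)" .
  then show "block_coeff w x \<in> H_space w"
    by (auto simp: H_space_def sums_iff block_coeff_def)
  show "H_norm_sq w (block_coeff w x) = (\<Sum>n\<in>half_block x. w n)"
    using s by (simp add: H_norm_sq_def sums_iff)
qed

lemma dirichlet_series_block_coeff:
  assumes x: "x \<ge> 2"
  shows "dirichlet_series (block_coeff w x) = (\<lambda>s. \<Sum>n\<in>half_block x. of_real (w n) * of_nat n powr (- s))"
proof
  fix s
  have "(\<lambda>n. block_coeff w x (Suc n) * of_nat (Suc n) powr (- s)) sums
     (\<Sum>n\<in>half_block x. block_coeff w x n * of_nat n powr (- s))"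
    by (rule sums_Suc_finite_support[where f = "\<lambda>n. block_coeff w x n * of_nat n powr (- s)"])
       (use zero_notin_half_block[OF x] in \<open>auto simp: block_coeff_def\<close>)
  then have "dirichlet_series (block_coeff w x) s = (\<Sum>n\<in>half_block x. block_coeff w x n * of_nat n powr (- s))"
    unfolding dirichlet_series_def dirichlet_term_def by (rule sums_unique[symmetric])
  also have "\<dots> = (\<Sum>n\<in>half_block x. of_real (w n) * of_nat n powr (- s))"
    by (intro sum.cong) (auto simp: block_coeff_def)
  finally show "dirichlet_series (block_coeff w x) s = \<dots>" .
qed

lemma deriv_dirichlet_series_block_coeff:
  assumes x: "x \<ge> 2"
  shows "deriv (dirichlet_series (block_coeff w x)) s
     = - (\<Sum>n\<in>half_block x. of_real (w n * ln (real n)) * of_nat n powr (- s))"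
proof (rule DERIV_imp_deriv)
  have "((\<lambda>s. of_real (w n) * of_nat n powr (- s)) has_field_derivative
       - (of_real (w n * ln (real n)) * of_nat n powr (- s))) (at s)" if "n \<in> half_block x" for n
  proof -
    have n: "n > 0" using half_block_ge_2[OF x that] by simp
    then have "of_nat n powr (- s) = exp (- s * of_real (ln (real n)))" for s :: complex
      by (simp add: powr_def Ln_of_nat)
    then show ?thesis by (auto intro!: derivative_eq_intros)
  qed
  then show "(dirichlet_series (block_coeff w x) has_field_derivative
      - (\<Sum>n\<in>half_block x. of_real (w n * ln (real n)) * of_nat n powr (- s))) (at s)"
    unfolding dirichlet_series_block_coeff[OF x] sum_negf[symmetric] by (rule DERIV_sum)
qed

text \<open>Cancels one factor V between a quadratic lower bound and a linear upper bound; V = 0 is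
  split off because there is nothing to cancel.\<close>

lemma le_of_square_le:
  fixes V c K y :: real
  assumes "V \<ge> 0" "c > 0" "y > 0" "c * V\<^sup>2 / y \<le> K * V" "K > 0"
  shows "V \<le> K / c * y"
proof (cases "V = 0")
  case False
  then have V: "V > 0" using assms by simp
  have "c * V\<^sup>2 \<le> K * V * y" using assms by (simp add: divide_le_eq)
  then have "V * (c * V) \<le> V * (K * y)" by (simp add: power2_eq_square mult_ac)
  then have "c * V \<le> K * y" using V by simp
  then show ?thesis using assms by (simp add: field_simps)
qed (use assms in simp)

text \<open>Tested on \<open>block_coeff\<close>, the embedding gives an upper bound linear in the
  block sum V, while the energy is bounded below quadratically in V. In each of the three cases the
  exponent of ln x in the lower bound comes out as \<alpha>.\<close>

lemma half_block_bound:
  assumes w: "\<And>n. n \<ge> 1 \<Longrightarrow> w n \<ge> 0" and emb: "locally_embedded w \<alpha>"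
  shows "\<exists>C>0. \<forall>x\<ge>2. (\<Sum>n\<in>half_block x. w n) \<le> C * (x / ln x powr \<alpha>)"
proof -
  have "is_interval {0..1 :: real} \<and> bounded {0..1 :: real}" by simp
  then obtain K where K: "K > 0"
    and le: "\<And>a. a \<in> H_space w \<Longrightarrow> local_energy \<alpha> {0..1} (dirichlet_series a) \<le> ennreal (K * H_norm_sq w a)"
    using emb unfolding locally_embedded_def by blast
  define V where "V = (\<lambda>x. \<Sum>n\<in>half_block x. w n)"
  have wb: "w n \<ge> 0" if "x \<ge> 2" "n \<in> half_block x" for x n
    using half_block_ge_2[OF that] by (intro w) simp
  have V: "V x \<ge> 0" if "x \<ge> 2" for x
    unfolding V_def using wb[OF that] by (rule sum_nonneg)
  have E: "local_energy \<alpha> {0..1} (dirichlet_series (block_coeff w x)) \<le> ennreal (K * V x)" if "x \<ge> 2" for x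
    using le[OF block_coeff_H(1)[OF that]] by (simp add: block_coeff_H(2)[OF that] V_def)
  have "\<exists>c>0. \<forall>x\<ge>2. c * (V x)\<^sup>2 / (x / ln x powr \<alpha>) \<le> K * V x"
  proof -
    consider (neg) "\<alpha> < 0" | (zero) "\<alpha> = 0" | (pos) "\<alpha> > 0" by linarith
    then show ?thesis
    proof cases
      case neg
      obtain \<kappa> where \<kappa>: "\<kappa> > 0" and ge: "\<And>x b. x \<ge> 2 \<Longrightarrow> (\<forall>n\<in>half_block x. b n \<ge> 0) \<Longrightarrow>
          ennreal (\<kappa> * (\<Sum>n\<in>half_block x. b n)\<^sup>2 / x * ln x powr (- (- \<alpha> - 1) - 1)) \<le>
          (\<integral>\<^sup>+s\<in>strip {0..1}. ennreal ((cmod (\<Sum>n\<in>half_block x. of_real (b n) * of_nat n powr (- s)))\<^sup>2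
              * (Re s - 1 / 2) powr (- \<alpha> - 1)) \<partial>lborel)"
        using strip_energy_ge[of "- \<alpha> - 1"] by blast
      have "\<kappa> * (V x)\<^sup>2 / (x / ln x powr \<alpha>) \<le> K * V x" if x: "x \<ge> 2" for x
      proof -
        have "\<forall>n\<in>half_block x. w n \<ge> 0" using wb[OF x] by blast
        from ge[OF x this] neg
        have "ennreal (\<kappa> * (V x)\<^sup>2 / x * ln x powr (- (- \<alpha> - 1) - 1)) \<le>
            local_energy \<alpha> {0..1} (dirichlet_series (block_coeff w x))"
          by (simp add: local_energy_def dirichlet_series_block_coeff[OF x] V_def)
        also have "\<dots> \<le> ennreal (K * V x)" by (rule E[OF x])
        finally show ?thesis using K V[OF x] by (simp add: ennreal_le_iff)
      qed
      with \<kappa> show ?thesis by blast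
    next
      case zero
      have "1 / 8 * (V x)\<^sup>2 / (x / ln x powr \<alpha>) \<le> K * V x" if x: "x \<ge> 2" for x
      proof -
        \<comment> \<open>Strictly to the right of 1/2, as the supremum demands, yet close enough
          for \<open>norm_sq_block_sum_ge\<close>.\<close>
        define \<sigma> where "\<sigma> = 1 / 2 + 1 / (4 * ln x)"
        have L: "ln x > 0" using x by simp
        have "ennreal ((V x)\<^sup>2 / (8 * x)) = (\<integral>\<^sup>+t\<in>{0..1::real}. ennreal ((V x)\<^sup>2 / (8 * x)) \<partial>lborel)"
          by (subst nn_integral_cmult_indicator) simp_all
        also have "\<dots> \<le> (\<integral>\<^sup>+t\<in>{0..1}. ennreal ((cmod (dirichlet_series (block_coeff w x) (Complex \<sigma> t)))\<^sup>2) \<partial>lborel)"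
          unfolding dirichlet_series_block_coeff[OF x] V_def using L
          by (intro nn_integral_mono)
             (auto simp: indicator_def \<sigma>_def intro!: ennreal_leI norm_sq_block_sum_ge x wb[OF x])
        also have "\<dots> \<le> local_energy \<alpha> {0..1} (dirichlet_series (block_coeff w x))"
          using zero L by (auto simp: local_energy_def \<sigma>_def intro!: SUP_upper)
        also have "\<dots> \<le> ennreal (K * V x)" by (rule E[OF x])
        finally show ?thesis using K V[OF x] zero L by (simp add: ennreal_le_iff)
      qed
      then show ?thesis by (intro exI[of _ "1 / 8"]) auto
    next
      case pos
      obtain \<kappa> where \<kappa>: "\<kappa> > 0" and ge: "\<And>x b. x \<ge> 2 \<Longrightarrow> (\<forall>n\<in>half_block x. b n \<ge> 0) \<Longrightarrow>
          ennreal (\<kappa> * (\<Sum>n\<in>half_block x. b n)\<^sup>2 / x * ln x powr (- (- \<alpha> + 1) - 1)) \<le>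
          (\<integral>\<^sup>+s\<in>strip {0..1}. ennreal ((cmod (\<Sum>n\<in>half_block x. of_real (b n) * of_nat n powr (- s)))\<^sup>2
              * (Re s - 1 / 2) powr (- \<alpha> + 1)) \<partial>lborel)"
        using strip_energy_ge[of "- \<alpha> + 1"] by blast
      have "\<kappa> / 4 * (V x)\<^sup>2 / (x / ln x powr \<alpha>) \<le> K * V x" if x: "x \<ge> 2" for x
      proof -
        have L: "ln x > 0" using x by simp
        \<comment> \<open>Differentiation multiplies the coefficients by ln n, at least half of ln x
          on the block; squared, this restores the two powers of ln x by which the exponent \<alpha>
          - 2 falls short.\<close>
        define U where "U = (\<Sum>n\<in>half_block x. w n * ln (real n))"
        have b: "\<forall>n\<in>half_block x. w n * ln (real n) \<ge> 0"
          using wb[OF x] half_block_ge_2[OF x] by force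
        have "ennreal (\<kappa> * U\<^sup>2 / x * ln x powr (- (- \<alpha> + 1) - 1)) \<le>
            local_energy \<alpha> {0..1} (dirichlet_series (block_coeff w x))"
          using ge[OF x b] pos
          by (simp add: local_energy_def deriv_dirichlet_series_block_coeff[OF x] U_def)
        also have "\<dots> \<le> ennreal (K * V x)" by (rule E[OF x])
        finally have 1: "\<kappa> * U\<^sup>2 / x * ln x powr (\<alpha> - 2) \<le> K * V x"
          using K V[OF x] by (simp add: ennreal_le_iff)
        have "V x * (ln x / 2) \<le> U"
          unfolding V_def U_def sum_distrib_right
          by (intro sum_mono mult_left_mono ln_half_block[OF x] wb[OF x])
        then have "(V x * (ln x / 2))\<^sup>2 \<le> U\<^sup>2"
          using V[OF x] L by (intro power_mono) auto
        then have "\<kappa> * (V x * (ln x / 2))\<^sup>2 / x * ln x powr (\<alpha> - 2) \<le> \<kappa> * U\<^sup>2 / x * ln x powr (\<alpha> - 2)"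
          using \<kappa> x by (intro mult_right_mono divide_right_mono mult_left_mono) auto
        moreover have "\<kappa> * (V x * (ln x / 2))\<^sup>2 / x * ln x powr (\<alpha> - 2) = \<kappa> / 4 * (V x)\<^sup>2 / (x / ln x powr \<alpha>)"
          using L by (simp add: power_mult_distrib power_divide powr_diff powr_numeral)
        ultimately show ?thesis using 1 by linarith
      qed
      with \<kappa> show ?thesis by (intro exI[of _ "\<kappa> / 4"]) auto
    qed
  qed
  then obtain c where c: "c > 0" and cV: "\<And>x. x \<ge> 2 \<Longrightarrow> c * (V x)\<^sup>2 / (x / ln x powr \<alpha>) \<le> K * V x"
    by blast
  have "V x \<le> K / c * (x / ln x powr \<alpha>)" if x: "x \<ge> 2" for x
    using x by (intro le_of_square_le V c cV K) auto
  then show ?thesis using K c by (intro exI[of _ "K / c"]) (auto simp: V_def)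
qed

section \<open>Summation over repeated halvings\<close>

text \<open>For x > 16 halving x shrinks x / (ln x)^\<alpha> by a factor of at most 2/3, which
  leaves room for one block: 2 K / 3 + C <= K once K >= 3 C. On [2, 16] the sum at 16 is compared
  with the minimum of that function.\<close>

lemma sum_bound_of_half_block_bound:
  fixes w :: "nat \<Rightarrow> real"
  assumes w: "\<And>n. n \<ge> 1 \<Longrightarrow> w n \<ge> 0" and \<alpha>: "\<alpha> \<le> 1" and C: "C > 0"
    and block: "\<And>x. x \<ge> 2 \<Longrightarrow> (\<Sum>n\<in>half_block x. w n) \<le> C * (x / ln x powr \<alpha>)"
  shows "\<exists>K>0. \<forall>x\<ge>2. (\<Sum>n | 1 \<le> n \<and> real n \<le> x. w n) \<le> K * (x / ln x powr \<alpha>)"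
proof -
  define S where "S = (\<lambda>x. \<Sum>n | 1 \<le> n \<and> real n \<le> x. w n)"
  have fin: "finite {n. 1 \<le> n \<and> real n \<le> x}" for x
    by (rule finite_subset[OF _ finite_nat_le_real[of x]]) auto
  have S_mono: "S x \<le> S y" if "x \<le> y" for x y
    unfolding S_def using that w by (intro sum_mono2 fin) auto
  have S_nonneg: "S x \<ge> 0" for x
    unfolding S_def using w by (intro sum_nonneg) auto
  have S_half: "S x = S (x / 2) + (\<Sum>n\<in>half_block x. w n)" if "x \<ge> 2" for x
  proof -
    have "{n. 1 \<le> n \<and> real n \<le> x} = {n. 1 \<le> n \<and> real n \<le> x / 2} \<union> half_block x"
      using that by (auto simp: half_block_def)
    moreover have "{n. 1 \<le> n \<and> real n \<le> x / 2} \<inter> half_block x = {}"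
      by (auto simp: half_block_def)
    ultimately show ?thesis
      unfolding S_def by (simp only: sum.union_disjoint fin finite_half_block)
  qed
  define g where "g = (\<lambda>x. x / ln x powr \<alpha>)"
  have g_pos: "g x > 0" if "x \<ge> 2" for x using that by (simp add: g_def)
  \<comment> \<open>\<open>g\<close> may decrease near 2 when \<alpha> is close to 1, so its
    positive lower bound on [2, 16] is taken from compactness.\<close>
  have "continuous_on {2..16} g"
    unfolding g_def by (intro continuous_intros) auto
  then obtain z where z: "z \<in> {2..16}" "\<And>x. x \<in> {2..16} \<Longrightarrow> g z \<le> g x"
    using continuous_attains_inf[of "{2..16}" g] by auto
  define K where "K = 3 * C + S 16 / g z"
  have gz: "g z > 0" using z by (intro g_pos) auto
  have K: "K > 0" "3 * C \<le> K" "S 16 / g z \<le> K"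
    using C S_nonneg[of 16] gz by (auto simp: K_def add_pos_nonneg)
  \<comment> \<open>Induction on the number of doublings beyond 16: halving moves x from the range
    of k + 1 to that of k, and for x > 16 the half stays above 2.\<close>
  have "S x \<le> K * g x" if "2 \<le> x" "x \<le> 16 * 2 ^ k" for k x
    using that
  proof (induction k arbitrary: x)
    case 0
    then have x: "x \<in> {2..16}" by simp
    have "S x \<le> S 16" using x by (intro S_mono) simp
    also have "\<dots> = S 16 / g z * g z" using gz by simp
    also have "\<dots> \<le> K * g x" using K gz z(2)[OF x] S_nonneg[of 16] by (intro mult_mono) auto
    finally show ?case .
  next
    case (Suc k)
    show ?case
    proof (cases "x \<le> 16")
      case True
      then have x: "x \<in> {2..16}" using Suc.prems by simp
      have "S x \<le> S 16" using x by (intro S_mono) simp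
      also have "\<dots> = S 16 / g z * g z" using gz by simp
      also have "\<dots> \<le> K * g x" using K gz z(2)[OF x] S_nonneg[of 16] by (intro mult_mono) auto
      finally show ?thesis .
    next
      case False
      then have x: "x > 16" by simp
      define L where "L = ln x"
      \<comment> \<open>The threshold 16 = 2^4 makes ln 2 at most a quarter of ln x, so that ln (x /
        2) >= 3/4 ln x.\<close>
      have "4 * ln 2 = ln (2 ^ 4 :: real)"
        by (simp only: ln_realpow zero_less_numeral of_nat_numeral)
      also have "\<dots> \<le> L" unfolding L_def using x by (subst ln_le_cancel_iff) auto
      finally have L4: "4 * ln 2 \<le> L" .
      have l2: "ln (2 :: real) > 0" by simp
      have L: "L > 0" "3 / 4 * L \<le> L - ln 2" "L - ln 2 > 0" using L4 l2 by linarith+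
      have "g (x / 2) = x / 2 * (L - ln 2) powr (- \<alpha>)"
        using x by (simp add: g_def L_def ln_div powr_minus_divide)
      \<comment> \<open>For \<alpha> >= 0 the ratio is at most (4/3)^\<alpha> <= 4/3 by \<alpha> <=
        1; for \<alpha> < 0 it is at most 1. With the 1/2 from x / 2 this yields the factor
        2/3.\<close>
      also have "(L - ln 2) powr (- \<alpha>) \<le> 4 / 3 * L powr (- \<alpha>)"
      proof (cases "\<alpha> \<ge> 0")
        case True
        have "(L - ln 2) powr (- \<alpha>) \<le> (3 / 4 * L) powr (- \<alpha>)"
          using L True by (intro powr_mono2') auto
        also have "\<dots> = (4 / 3) powr \<alpha> * L powr (- \<alpha>)"
          using L by (simp add: powr_mult powr_minus_divide powr_divide)
        also have "\<dots> \<le> (4 / 3) powr 1 * L powr (- \<alpha>)"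
          using \<alpha> by (intro mult_right_mono powr_mono) auto
        finally show ?thesis by simp
      next
        case False
        have "(L - ln 2) powr (- \<alpha>) \<le> L powr (- \<alpha>)"
          by (intro powr_mono2) (use L l2 False in linarith)+
        also have "\<dots> \<le> 4 / 3 * L powr (- \<alpha>)" by simp
        finally show ?thesis .
      qed
      finally have "g (x / 2) \<le> 2 / 3 * g x"
        using x by (simp add: g_def L_def powr_minus_divide)
      have "S x = S (x / 2) + (\<Sum>n\<in>half_block x. w n)" using x by (intro S_half) simp
      also have "\<dots> \<le> K * g (x / 2) + C * g x"
        unfolding g_def using x Suc.prems by (intro add_mono block Suc.IH[unfolded g_def]) auto
      also have "\<dots> \<le> K * (2 / 3 * g x) + (K / 3) * g x"
        using K g_pos[of x] x \<open>g (x / 2) \<le> 2 / 3 * g x\<close>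
        by (intro add_mono mult_left_mono mult_right_mono) auto
      also have "\<dots> = K * g x" by (simp add: algebra_simps)
      finally show ?thesis .
    qed
  qed
  moreover have "\<exists>k. x \<le> 16 * 2 ^ k" for x :: real
    using real_arch_pow[of 2 x] by (smt (verit) zero_le_power)
  ultimately have "S x \<le> K * g x" if "x \<ge> 2" for x using that by blast
  then show ?thesis using K by (auto simp: S_def g_def)
qed

theorem theorem1:
  fixes w :: "nat \<Rightarrow> real" and \<alpha> :: real
  assumes "\<And>n. n \<ge> 1 \<Longrightarrow> w n \<ge> 0"
    and "\<alpha> \<le> 1"
  shows "(\<exists>C>0. \<forall>x::real. x \<ge> 2 \<longrightarrow>
            (\<Sum>n | 1 \<le> n \<and> real n \<le> x. w n) \<le> C * (x / (ln x) powr \<alpha>))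
         \<longleftrightarrow> locally_embedded w \<alpha>"
proof
  assume "\<exists>C>0. \<forall>x::real. x \<ge> 2 \<longrightarrow>
            (\<Sum>n | 1 \<le> n \<and> real n \<le> x. w n) \<le> C * (x / (ln x) powr \<alpha>)"
  then obtain C where "C > 0" "\<And>x. x \<ge> 2 \<Longrightarrow> (\<Sum>n | 1 \<le> n \<and> real n \<le> x. w n) \<le> C * (x / (ln x) powr \<alpha>)"
    by blast
  then interpret dyadic_weight w \<alpha> "2 * C * ln 2 powr (- \<alpha>)"
    by (intro dyadic_weight_of_sum_bound assms(1))
  show "locally_embedded w \<alpha>" by (rule locally_embedded[OF assms(2)])
next
  assume "locally_embedded w \<alpha>"
  then obtain C where "C > 0" "\<And>x. x \<ge> 2 \<Longrightarrow> (\<Sum>n\<in>half_block x. w n) \<le> C * (x / ln x powr \<alpha>)"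
    using half_block_bound[of w \<alpha>] assms(1) by blast
  then show "\<exists>C>0. \<forall>x::real. x \<ge> 2 \<longrightarrow>
            (\<Sum>n | 1 \<le> n \<and> real n \<le> x. w n) \<le> C * (x / (ln x) powr \<alpha>)"
    by (intro sum_bound_of_half_block_bound assms)
qed

end
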